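(* Let $N\ge4$. For all positive integers $\alpha,\beta$ with $\alpha+\beta\le N$, all $m\ge1$ and all $\gamma_1,\dots,\gamma_m\in\{1,\dots,N-1\}$, $$\left.\frac{\partial^{m+2}F_{D_N}}{\partial t_\alpha\,\partial t_\beta\,\partial t_{N-\gamma_1}\cdots\partial t_{N-\gamma_m}}\right|_{t=0}=(-1)^{m-1}(m-1)!\cdot\widehat P_{2\alpha-1,2\beta-1}(2\gamma_1-1,\dots,2\gamma_m-1).$$
   Context: The $D_N$ Frobenius potential $F_{D_N}$ ($N\ge4$). The coordinates $t_1,\dots,t_{N-1}$ and $v_1,\dots,v_{N-1}$ are related by the invertible polynomial change $$t_\gamma=\sum_{\substack{a_1,\dots,a_{N-1}\ge0\\ \sum_k(N-k)a_k=N-\gamma}}(-1)^{|a|-1}\prod_{k=0}^{|a|-2}\bigl(2\gamma-1+2k(N-1)\bigr)\prod_{k=1}^{N-1}\frac{v_k^{a_k}}{a_k!},\qquad1\le\gamma\le N-1,\quad|a|=\sum_ka_k$$ (empty products equal $1$). $F_{D_N}\in\mathbb{Q}[t_1,\dots,t_N]$ is the polynomial without constant term determined by $\frac{\partial F_{D_N}}{\partial t_N}=v_1\,t_N$ and, for $1\le\alpha\le N-1$, $$\left.\frac{\partial F_{D_N}}{\partial t_\alpha}\right|_{t_N=0}=\sum_{\substack{a_1,\dots,a_{N-1}\ge0\\ \sum_k(N-k)a_k=N-1+\alpha}}(-1)^{|a|}\prod_{k=0}^{|a|-3}\bigl(2(N-\alpha)-1+2k(N-1)\bigr)\prod_{k=1}^{N-1}\frac{v_k^{a_k}}{a_k!},$$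 where $v_k=v_k(t_1,\dots,t_{N-1})$. For positive integers $i,j,m,\gamma_1,\dots,\gamma_m$, $\widehat P_{ij}(\gamma_1,\dots,\gamma_m)$ is the number of pairs of ordered $m$-tuples of positive integers $(i_1,\dots,i_m)$, $(j_1,\dots,j_m)$ with $\sum_ki_k=i$, $\sum_kj_k=j$ and $i_k+j_k=\gamma_k+1$ for all $k$. *)

theory Defs
  imports Complex_Main "HOL-Library.Poly_Mapping"
begin

section \<open>Multivariate polynomials\<close>

text \<open>Monomials are finitely supported exponent functions, polynomials are finitely supported
  coefficient functions; the ring structure is the convolution product of
  \<^theory>\<open>HOL-Library.Poly_Mapping\<close>.\<close>

type_synonym 'a mpoly = "(nat \<Rightarrow>\<^sub>0 nat) \<Rightarrow>\<^sub>0 'a"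

definition Const :: "'a::comm_ring_1 \<Rightarrow> 'a mpoly" where
  "Const c = Poly_Mapping.single 0 c"

definition Var :: "nat \<Rightarrow> 'a::comm_ring_1 mpoly" where
  "Var i = Poly_Mapping.single (Poly_Mapping.single i 1) 1"

definition vars :: "'a::comm_ring_1 mpoly \<Rightarrow> nat set" where
  "vars p = (\<Union>m\<in>Poly_Mapping.keys p. Poly_Mapping.keys m)"

definition pderiv :: "nat \<Rightarrow> 'a::comm_ring_1 mpoly \<Rightarrow> 'a mpoly" where
  "pderiv i p = (\<Sum>m\<in>Poly_Mapping.keys p.
     Poly_Mapping.single (m - Poly_Mapping.single i 1)
       (of_nat (Poly_Mapping.lookup m i) * Poly_Mapping.lookup p m))"

definition pderivs :: "nat list \<Rightarrow> 'a::comm_ring_1 mpoly \<Rightarrow> 'a mpoly" where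
  "pderivs ks p = foldr pderiv ks p"

definition subst :: "(nat \<Rightarrow> 'a::comm_ring_1 mpoly) \<Rightarrow> 'a mpoly \<Rightarrow> 'a mpoly" where
  "subst \<sigma> p = (\<Sum>m\<in>Poly_Mapping.keys p.
     Const (Poly_Mapping.lookup p m) *
       (\<Prod>i\<in>Poly_Mapping.keys m. \<sigma> i ^ Poly_Mapping.lookup m i))"

definition eval :: "(nat \<Rightarrow> 'a::comm_ring_1) \<Rightarrow> 'a mpoly \<Rightarrow> 'a" where
  "eval x p = (\<Sum>m\<in>Poly_Mapping.keys p.
     Poly_Mapping.lookup p m *
       (\<Prod>i\<in>Poly_Mapping.keys m. x i ^ Poly_Mapping.lookup m i))"

definition set_var_zero :: "nat \<Rightarrow> 'a::comm_ring_1 mpoly \<Rightarrow> 'a mpoly" where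
  "set_var_zero n = subst (\<lambda>i. if i = n then 0 else Var i)"


section \<open>The potential of type \<open>D\<^sub>N\<close>\<close>

text \<open>The variable \<open>t\<^sub>i\<close> is \<open>Var i\<close>, for \<open>1 \<le> i \<le> N\<close>.\<close>

definition weighted_exps :: "nat \<Rightarrow> nat \<Rightarrow> (nat \<Rightarrow> nat) set" where
  "weighted_exps N w =
     {a. (\<forall>k. k \<notin> {1..N-1} \<longrightarrow> a k = 0) \<and> (\<Sum>k=1..N-1. (N - k) * a k) = w}"

definition exp_size :: "nat \<Rightarrow> (nat \<Rightarrow> nat) \<Rightarrow> nat" where
  "exp_size N a = (\<Sum>k=1..N-1. a k)"

text \<open>The sums over \<^const>\<open>weighted_exps\<close> below are genuine finite sums.\<close>

lemma finite_weighted_exps: "finite (weighted_exps N w)"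
proof (rule finite_subset)
  show "weighted_exps N w \<subseteq>
      {a. \<forall>k. (k \<in> {1..N-1} \<longrightarrow> a k \<in> {..w}) \<and> (k \<notin> {1..N-1} \<longrightarrow> a k = 0)}"
  proof
    fix a assume a: "a \<in> weighted_exps N w"
    have "a k \<le> w" if k: "k \<in> {1..N-1}" for k
    proof -
      have "a k \<le> (N - k) * a k" using k by auto
      also have "\<dots> \<le> (\<Sum>k=1..N-1. (N - k) * a k)"
        by (rule member_le_sum[OF k]) auto
      also have "\<dots> = w" using a by (simp add: weighted_exps_def)
      finally show ?thesis .
    qed
    then show "a \<in> {a. \<forall>k. (k \<in> {1..N-1} \<longrightarrow> a k \<in> {..w}) \<and> (k \<notin> {1..N-1} \<longrightarrow> a k = 0)}"
      using a by (auto simp: weighted_exps_def)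
  qed
  show "finite {a. \<forall>k. (k \<in> {1..N-1} \<longrightarrow> a k \<in> {..w}) \<and> (k \<notin> {1..N-1} \<longrightarrow> a k = (0::nat))}"
    by (rule finite_set_of_finite_funs) auto
qed

text \<open>\<open>\<Prod>\<^sub>k v\<^sub>k\<^bsup>a\<^sub>k\<^esup> / a\<^sub>k!\<close>\<close>

definition divided_monom :: "nat \<Rightarrow> (nat \<Rightarrow> rat mpoly) \<Rightarrow> (nat \<Rightarrow> nat) \<Rightarrow> rat mpoly" where
  "divided_monom N v a = (\<Prod>k=1..N-1. Const (1 / fact (a k)) * v k ^ a k)"

text \<open>For \<open>1 \<le> \<gamma>, \<alpha> \<le> N - 1\<close>, every exponent occurring in \<open>t_of_v\<close> has size at least 1 and every
  exponent occurring in \<open>dF_of_v\<close> has size at least 2, so the truncated subtractions in the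
  exponent and in the product ranges agree with the empty-product convention.\<close>

definition t_of_v :: "nat \<Rightarrow> (nat \<Rightarrow> rat mpoly) \<Rightarrow> nat \<Rightarrow> rat mpoly" where
  "t_of_v N v \<gamma> = (\<Sum>a\<in>weighted_exps N (N - \<gamma>).
     Const ((-1) ^ (exp_size N a - 1) *
       (\<Prod>k<exp_size N a - 1. 2 * of_nat \<gamma> - 1 + 2 * of_nat k * (of_nat N - 1))) *
     divided_monom N v a)"

definition dF_of_v :: "nat \<Rightarrow> (nat \<Rightarrow> rat mpoly) \<Rightarrow> nat \<Rightarrow> rat mpoly" where
  "dF_of_v N v \<alpha> = (\<Sum>a\<in>weighted_exps N (N - 1 + \<alpha>).
     Const ((-1) ^ exp_size N a *
       (\<Prod>k<exp_size N a - 2.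
          2 * (of_nat N - of_nat \<alpha>) - 1 + 2 * of_nat k * (of_nat N - 1))) *
     divided_monom N v a)"

text \<open>\<open>v\<^sub>1, \<dots>, v\<^bsub>N-1\<^esub>\<close> as polynomials in \<open>t\<^sub>1, \<dots>, t\<^bsub>N-1\<^esub>\<close>. The change of coordinates has the
  triangular form \<open>t\<^sub>\<gamma> = v\<^sub>\<gamma> + (polynomial in v\<^sub>k, k > \<gamma>)\<close>, so this one-sided condition
  determines \<open>v k\<close> for \<open>1 \<le> k \<le> N - 1\<close>; the other values of \<open>v\<close> are never used.\<close>

definition is_D_coords :: "nat \<Rightarrow> (nat \<Rightarrow> rat mpoly) \<Rightarrow> bool" where
  "is_D_coords N v \<longleftrightarrow>
     (\<forall>k\<in>{1..N-1}. vars (v k) \<subseteq> {1..N-1}) \<and>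
     (\<forall>\<gamma>\<in>{1..N-1}. t_of_v N v \<gamma> = Var \<gamma>)"

text \<open>These conditions fix all first partial derivatives of \<open>F\<close> and its constant term, hence
  \<open>F\<close> itself.\<close>

definition is_D_potential :: "nat \<Rightarrow> rat mpoly \<Rightarrow> bool" where
  "is_D_potential N F \<longleftrightarrow>
     vars F \<subseteq> {1..N} \<and> Poly_Mapping.lookup F 0 = 0 \<and>
     (\<exists>v. is_D_coords N v \<and>
        pderiv N F = v 1 * Var N \<and>
        (\<forall>\<alpha>\<in>{1..N-1}. set_var_zero N (pderiv \<alpha> F) = dF_of_v N v \<alpha>))"


section \<open>Counting pairs of tuples\<close>

definition P_hat :: "nat \<Rightarrow> nat \<Rightarrow> nat list \<Rightarrow> nat" where
  "P_hat i j \<gamma>s = card {(is, js).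
     length is = length \<gamma>s \<and> length js = length \<gamma>s \<and>
     (\<forall>k<length \<gamma>s. is ! k \<ge> 1 \<and> js ! k \<ge> 1 \<and> is ! k + js ! k = \<gamma>s ! k + 1) \<and>
     sum_list is = i \<and> sum_list js = j}"

end

(* With t_N = 0 the superpotential is lambda = p^(2N-2) + (2N-2) * sum_k v_k p^(2k-2). Setting
   z = lambda^(1/(2N-2)), the formulas for t_gamma and dF/dt_alpha are the residues of z^(2(N-gamma)-1) dp
   and z^(2N-2+2alpha-1) dp up to constants. So p = z - sum_g t_(N-g) z^(1-2g) + ..., and, for i = 2alpha-1
   and j = 2beta-1, i * j * d^2F/dt_alpha dt_beta is the residue of z^i d(z^j)_+, where + denotes the
   polynomial part in p. By Lagrange inversion this second derivative is the coefficient of x^i y^j, x = 1/z,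
   y = 1/w, in log((p(z) - p(w))/(z - w)) = log(1 + sum_g t_(N-g) sum_(a+b=2g) x^a y^b). For
   alpha + beta <= N this coefficient only involves the g <= N - 1, and its Taylor expansion
   in t has the coefficients (-1)^(m-1) (m-1)! P_hat. *)

theory Submission
  imports Defs "HOL-Computational_Algebra.Polynomial"
    "HOL-Computational_Algebra.Formal_Laurent_Series"
begin

hide_const (open) Polynomial.pderiv

unbundle fps_syntax

section \<open>Lagrange inversion\<close>

text \<open>All computations take place at a rational point with t_N = 0. There the v_k are numbers
  and z/p is a univariate series in u = p^(-2), so residues in p become coefficients of powers of u.
  The change of coordinates is never inverted: differentiating it along t_\<beta> gives a
  unitriangular linear system for the derivatives of the v_k. Its solution is (1/j) d(z^j)/dp cut
  down to its polynomial part, because z^(2e-j) d(z^j) is exact, hence without residue, unless e =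
  0. The logarithm comes from log(1 - p(x)/p(y)), with p(x) the value of p at z = 1/x: its terms are
  products of p(x)^n and p(y)^(-n), and Lagrange inversion turns their coefficients into those of
  z^i and d(z^j)_+. The kernel has positive order in y, so each coefficient of y^j is a finite sum,
  polynomial in t. The second derivative thus agrees with an explicit polynomial on the hyperplane
  t_N = 0, and all further derivatives are taken inside that hyperplane.\<close>

lemma fps_compose_mult_nth:
  fixes a b d :: "'a::idom fps"
  assumes "b $ 0 = 0"
  shows "((a oo b) * d) $ m = (\<Sum>l=0..m. a $ l * (b ^ l * d) $ m)"
proof -
  have "((a oo b) * d) $ m = (\<Sum>i=0..m. (\<Sum>l=0..i. a $ l * b ^ l $ i) * d $ (m - i))"
    by (simp add: fps_mult_nth fps_compose_nth)
  also have "\<dots> = (\<Sum>i=0..m. (\<Sum>l=0..m. a $ l * b ^ l $ i) * d $ (m - i))"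
    using assms
    by (intro sum.cong refl arg_cong[of _ _ "\<lambda>x. x * _"] sum.mono_neutral_left)
       (auto simp: startsby_zero_power_prefix)
  also have "\<dots> = (\<Sum>l=0..m. \<Sum>i=0..m. a $ l * (b ^ l $ i * d $ (m - i)))"
    by (subst sum.swap) (simp add: sum_distrib_right mult.assoc)
  finally show ?thesis
    by (simp add: fps_mult_nth sum_distrib_left)
qed

text \<open>\<open>W a\<close> models (z/p)^a as a series in u = p^(-2), for every scalar exponent
  a, and \<open>ell\<close> the logarithmic derivative u d/du log(z/p); \<open>W_log\<close> is the
  power rule read off coefficientwise.\<close>

locale series_powers =
  fixes W :: "'a::field_char_0 \<Rightarrow> 'a fps" and ell :: "'a fps"
  assumes W_add: "W (a + b) = W a * W b"
    and W_nth_0 [simp]: "W a $ 0 = 1"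
    and W_log: "of_nat m * W a $ m = a * (W a * ell) $ m"
begin

lemma W_0 [simp]: "W 0 = 1"
proof -
  have "W 0 \<noteq> 0"
    using W_nth_0[of 0] by force
  with W_add[of 0 0] show ?thesis by simp
qed

lemma ell_nth_0: "ell $ 0 = 0"
  using W_log[of 0 1] by simp

lemma W_power: "W a ^ n = W (of_nat n * a)"
  by (induction n) (simp_all add: algebra_simps flip: W_add)

lemma W_inverse: "inverse (W a) = W (- a)"
  using W_add[of a "-a"] by (intro fps_inverse_unique) simp

lemma mult_1_minus_2_ell_nth: "(A * (1 - 2 * ell)) $ m = A $ m - 2 * (A * ell) $ m"
proof -
  have "A * (1 - 2 * ell) = A - fps_const 2 * (A * ell)"
    by (simp add: algebra_simps numeral_fps_const)
  then show ?thesis by simp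
qed

text \<open>Since du/u = -2 dp/p, the factor \<open>1 - 2 * ell\<close> is (p/z) dz/dp. The
  coefficient is therefore the residue of z^(2m-1) dz, an exact form unless m = 0.\<close>

lemma residue_exact:
  "(W (2 * of_nat m) * (1 - 2 * ell)) $ m = (if m = 0 then 1 else 0)"
proof -
  have "(W (2 * of_nat m) * (1 - 2 * ell)) $ m
      = W (2 * of_nat m) $ m - 2 * (W (2 * of_nat m) * ell) $ m"
    by (rule mult_1_minus_2_ell_nth)
  moreover have "2 * (W (2 * of_nat m) * ell) $ m = W (2 * of_nat m) $ m" if "m > 0"
    using W_log[of m "2 * of_nat m"] that by simp
  ultimately show ?thesis by (simp add: ell_nth_0)
qed

text \<open>\<open>fps_X * W (-2)\<close> is z^(-2), so \<open>f\<close> expands (z/p)^n in powers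
  of z^(-2), and \<open>f $ m\<close> is the residue of z^(2m-1) (z/p)^n dz. The factor n + 2m is
  kept on the left because it may vanish.\<close>

lemma lagrange:
  assumes f: "f oo (fps_X * W (-2)) = W n"
  shows "(n + 2 * of_nat m) * f $ m = n * W (n + 2 * of_nat m) $ m"
proof -
  let ?g = "fps_X * W (-2)" and ?d = "W (2 * of_nat m) * (1 - 2 * ell)"
  \<comment> \<open>\<open>?d\<close> represents z^(2m-1) dz, which pairs to 1 with z^(-2m) and to 0
    with the other z^(-2l); it extracts \<open>f $ m\<close>.\<close>
  have coeff: "(?g ^ l * ?d) $ m = (if l = m then 1 else 0)" if "l \<le> m" for l
  proof -
    have eq: "2 * of_nat (m - l) = of_nat l * (-2) + 2 * (of_nat m :: 'a)"
      using that by (simp add: of_nat_diff)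
    have "?g ^ l * ?d = fps_X ^ l * (W (2 * of_nat (m - l)) * (1 - 2 * ell))"
      unfolding eq W_add by (simp add: power_mult_distrib W_power)
    then have "(?g ^ l * ?d) $ m = (W (2 * of_nat (m - l)) * (1 - 2 * ell)) $ (m - l)"
      using that by (simp only: fps_X_power_mult_nth) simp
    then show ?thesis
      unfolding residue_exact using that by auto
  qed
  have "f $ m = (\<Sum>l=0..m. f $ l * (if l = m then 1 else 0))"
    by (simp add: if_distrib[of "\<lambda>x. _ * x"] cong: if_cong)
  also have "\<dots> = (\<Sum>l=0..m. f $ l * (?g ^ l * ?d) $ m)"
    by (intro sum.cong refl) (simp only: coeff atLeastAtMost_iff)
  also have "\<dots> = ((f oo ?g) * ?d) $ m"
    by (simp add: fps_compose_mult_nth)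
  also have "\<dots> = (W (n + 2 * of_nat m) * (1 - 2 * ell)) $ m"
    by (simp add: f W_add mult.assoc)
  also have "\<dots> = W (n + 2 * of_nat m) $ m - 2 * (W (n + 2 * of_nat m) * ell) $ m"
    by (rule mult_1_minus_2_ell_nth)
  finally have "(n + 2 * of_nat m) * f $ m
      = (n + 2 * of_nat m) * (W (n + 2 * of_nat m) $ m - 2 * (W (n + 2 * of_nat m) * ell) $ m)"
    by simp
  also have "\<dots> = (n + 2 * of_nat m) * W (n + 2 * of_nat m) $ m
        - 2 * ((n + 2 * of_nat m) * (W (n + 2 * of_nat m) * ell) $ m)"
    by (simp only: right_diff_distrib mult.left_commute)
  also have "\<dots> = n * W (n + 2 * of_nat m) $ m"
    unfolding W_log[symmetric] by (simp only: ring_distribs) simp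
  finally show ?thesis .
qed

text \<open>The numbers (j - 2r) \<open>W j $ r\<close> are the coefficients of d(z^j)/dp, so the
  sum is the residue of z^(2e-j) d(z^j) = j z^(2e-1) dz.\<close>

lemma orthogonality:
  "(\<Sum>r=0..e. (j - 2 * of_nat r) * W j $ r * W (2 * of_nat e - j) $ (e - r))
    = (if e = 0 then j else 0)"
proof -
  let ?V = "W (2 * of_nat e - j)"
  have "(j - 2 * of_nat r) * W j $ r = j * (W j * (1 - 2 * ell)) $ r" for r
  proof -
    have "(j - 2 * of_nat r) * W j $ r = j * W j $ r - 2 * (of_nat r * W j $ r)"
      by (simp add: algebra_simps)
    also have "\<dots> = j * (W j * (1 - 2 * ell)) $ r"
      unfolding W_log mult_1_minus_2_ell_nth by (simp add: algebra_simps)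
    finally show ?thesis .
  qed
  then have "(\<Sum>r=0..e. (j - 2 * of_nat r) * W j $ r * ?V $ (e - r))
      = j * (W j * (1 - 2 * ell) * ?V) $ e"
    by (simp only: fps_mult_nth[of "W j * (1 - 2 * ell)" ?V] sum_distrib_left) (simp only: mult.assoc)
  also have "W j * (1 - 2 * ell) * ?V = W (2 * of_nat e) * (1 - 2 * ell)"
    using W_add[of j "2 * of_nat e - j"] by (simp add: algebra_simps)
  finally show ?thesis by (simp add: residue_exact)
qed

text \<open>With \<open>z = p W 1 (1/p\<^sup>2)\<close>, the series \<open>f\<close> expresses \<open>p/z\<close> in terms of \<open>1/z\<^sup>2\<close>.\<close>

lemma inverse_series_exists:
  obtains f where
    "f $ 0 = 1"
    "\<And>n m. (2 * of_nat m - of_nat n) * (f ^ n) $ m = - of_nat n * W (2 * of_nat m - of_nat n) $ m"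
    "\<And>n m. (2 * of_nat m + of_nat n) * (inverse f ^ n) $ m = of_nat n * W (2 * of_nat m + of_nat n) $ m"
proof -
  let ?g = "fps_X * W (-2)"
  have g0: "?g $ 0 = 0" and g1: "?g $ 1 \<noteq> 0"
    by (simp_all add: fps_mult_nth)
  define f where "f = W (-1) oo fps_inv ?g"
  have inv0: "fps_inv ?g $ 0 = 0" by (simp add: fps_inv_def)
  have fg: "f oo ?g = W (-1)"
    unfolding f_def fps_compose_assoc[OF g0 inv0, symmetric] fps_inv[OF g0 g1] by simp
  have f0: "f $ 0 = 1" by (simp add: f_def)
  have pow: "f ^ n oo ?g = W (- of_nat n)" for n
    by (simp add: fps_compose_power[OF g0, symmetric] fg W_power)
  have ipow: "inverse f ^ n oo ?g = W (of_nat n)" for n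
    by (simp add: fps_compose_power[OF g0, symmetric] fps_inverse_compose[OF g0] f0 fg
        W_power W_inverse)
  show thesis
  proof
    show "f $ 0 = 1" by (rule f0)
    show "(2 * of_nat m - of_nat n) * (f ^ n) $ m = - of_nat n * W (2 * of_nat m - of_nat n) $ m"
      for n m using lagrange[OF pow, of n m] by simp
    show "(2 * of_nat m + of_nat n) * (inverse f ^ n) $ m = of_nat n * W (2 * of_nat m + of_nat n) $ m"
      for n m using lagrange[OF ipow, of n m] by (simp add: add.commute)
  qed
qed

end

section \<open>The logarithm of the two-point kernel\<close>

text \<open>The n-th power of \<open>W\<close> has order at least n. The cut-off \<open>K\<close> is
  left free so that it can later also bound the number of derivatives.\<close>

lemma fps_ln_compose_nth:
  fixes W :: "'a::field_char_0 fps"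
  assumes "W $ 0 = 0" "j \<le> K"
  shows "(fps_ln 1 oo W) $ j = (\<Sum>n=1..K. (- 1) ^ (n - 1) / of_nat n * (W ^ n) $ j)"
proof -
  have "(fps_ln 1 oo W) $ j = (\<Sum>n=0..K. fps_ln 1 $ n * (W ^ n) $ j)"
    unfolding fps_compose_nth using assms
    by (intro sum.mono_neutral_left) (auto simp: startsby_zero_power_prefix)
  also have "\<dots> = (\<Sum>n=1..K. fps_ln 1 $ n * (W ^ n) $ j)"
    by (intro sum.mono_neutral_right) (auto simp: not_le)
  also have "\<dots> = (\<Sum>n=1..K. (- 1) ^ (n - 1) / of_nat n * (W ^ n) $ j)"
    by (intro sum.cong refl) (simp add: fps_ln_nth)
  finally show ?thesis .
qed

text \<open>Both sides have constant term 0, so it suffices to compare their derivatives, in which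
  no logarithm is left.\<close>

lemma fps_ln_compose_mult:
  fixes U V :: "'a::field_char_0 fps"
  assumes U: "U $ 0 = 0" and V: "V $ 0 = 0"
  shows "fps_ln 1 oo ((1 + U) * (1 + V) - 1) = (fps_ln 1 oo U) + (fps_ln 1 oo V)"
proof -
  have deriv: "fps_deriv (fps_ln 1 oo W) = inverse (1 + W) * fps_deriv W"
    if W: "W $ 0 = 0" for W :: "'a fps"
  proof -
    have "inverse (1 + fps_X) oo W = inverse (1 + W)"
      using W by (simp add: fps_inverse_compose fps_compose_add_distrib fps_X_fps_compose_startby0)
    then show ?thesis by (simp add: fps_compose_deriv W fps_ln_deriv)
  qed
  let ?P = "(1 + U) * (1 + V) - 1"
  have P: "?P $ 0 = 0" by (simp add: U V)
  have inv: "inverse (1 + U) * (1 + U) = 1" "inverse (1 + V) * (1 + V) = 1"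
    by (simp_all add: inverse_mult_eq_1 U V)
  have "fps_deriv (fps_ln 1 oo ?P) = inverse (1 + U) * inverse (1 + V) *
      (fps_deriv U * (1 + V) + (1 + U) * fps_deriv V)"
    unfolding deriv[OF P] by (simp add: fps_inverse_mult)
  also have "\<dots> = inverse (1 + U) * (inverse (1 + V) * (1 + V)) * fps_deriv U
      + (inverse (1 + U) * (1 + U)) * inverse (1 + V) * fps_deriv V"
    by (simp only: ring_distribs mult_ac)
  also have "\<dots> = fps_deriv ((fps_ln 1 oo U) + (fps_ln 1 oo V))"
    by (simp add: inv deriv U V)
  finally show ?thesis
    unfolding fps_deriv_eq_iff by simp
qed

text \<open>Elements of \<^typ>\<open>rat fls fps\<close> are power series in \<open>y\<close> whose coefficients are Laurent
  series in \<open>x\<close>.\<close>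

definition lift_y :: "rat fps \<Rightarrow> rat fls fps" where
  "lift_y f = Abs_fps (\<lambda>n. fls_const (f $ n))"

text \<open>\<open>\<Sum> x\<^sup>a y\<^sup>b\<close> over \<open>a, b \<ge> 1\<close> with \<open>a + b = 2 g\<close>; in products its exponents are counted by
  \<^const>\<open>P_hat\<close>.\<close>

definition pair_kernel :: "nat \<Rightarrow> rat fls fps" where
  "pair_kernel g = (\<Sum>l=1..2*g-1. fps_const (fls_X ^ (2 * g - l)) * fps_X ^ l)"

lemma fls_const_sum: "fls_const (sum f A) = (\<Sum>a\<in>A. fls_const (f a))"
  by (rule fls_eqI) (simp add: fls_nth_sum)

lemma lift_y_mult: "lift_y (f * g) = lift_y f * lift_y g"
  by (rule fps_ext) (simp add: lift_y_def fps_mult_nth fls_const_sum)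

lemma lift_y_1: "lift_y 1 = 1"
  by (rule fps_ext) (simp add: lift_y_def)

lemma lift_y_power: "lift_y (f ^ n) = lift_y f ^ n"
  by (induction n) (simp_all add: lift_y_mult lift_y_1)

lemma lift_y_nth: "lift_y f $ n = fls_const (f $ n)"
  by (simp add: lift_y_def)

lemma fps_compose_X2_nth:
  fixes f :: "'a::idom fps"
  shows "(f oo fps_X ^ 2) $ m = (if even m then f $ (m div 2) else 0)"
proof -
  have "(f oo fps_X ^ 2) $ m = (\<Sum>i=0..m. if m = 2 * i then f $ i else 0)"
    unfolding fps_compose_nth
    by (intro sum.cong refl) (auto simp: power_mult[symmetric] fps_X_power_nth)
  also have "\<dots> = (\<Sum>i\<in>{0..m} \<inter> {i. m = 2 * i}. f $ i)"
    by (subst sum.inter_restrict) auto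
  also have "{0..m} \<inter> {i. m = 2 * i} = (if even m then {m div 2} else {})"
    by auto
  finally show ?thesis by simp
qed

text \<open>The sum telescopes. This exhibits the kernel as a divided difference, which ties it to
  p(x) - p(y).\<close>

lemma pair_kernel_identity:
  assumes "g \<ge> 1"
  shows "(fps_const fls_X - fps_X) * pair_kernel g
       = fps_const (fls_X ^ (2 * g)) * fps_X - fps_const fls_X * fps_X ^ (2 * g)"
proof -
  let ?t = "\<lambda>l. fps_const (fls_X ^ (2 * g - l + 1)) * fps_X ^ l :: rat fls fps"
  have "(fps_const fls_X - fps_X) * pair_kernel g = (\<Sum>l=1..2*g-1. ?t l - ?t (Suc l))"
    unfolding pair_kernel_def sum_distrib_left
  proof (intro sum.cong refl)
    fix l assume "l \<in> {1..2*g-1}"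
    then have "2 * g - Suc l + 1 = 2 * g - l" by auto
    then show "(fps_const fls_X - fps_X) * (fps_const (fls_X ^ (2 * g - l)) * fps_X ^ l)
        = ?t l - ?t (Suc l)"
      by (simp add: algebra_simps flip: fps_const_mult)
  qed
  also have "\<dots> = (\<Sum>l=1..<2*g. ?t l - ?t (Suc l))"
    using assms by (intro sum.cong) auto
  also have "\<dots> = ?t 1 - ?t (2 * g)"
    using assms sum_Suc_diff'[of 1 "2 * g" "\<lambda>l. - ?t l"] by simp
  finally show ?thesis using assms by simp
qed

lemma fps_const_sum: "fps_const (sum f A) = (\<Sum>a\<in>A. fps_const (f a))"
  by (induction A rule: infinite_finite_induct) (auto simp flip: fps_const_add)

lemma fps_to_fls_sum: "fps_to_fls (sum f A) = (\<Sum>a\<in>A. fps_to_fls (f a))"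
  by (induction A rule: infinite_finite_induct) auto

lemma fps_ln_compose_nth_nth:
  fixes W :: "rat fls fps"
  assumes "W $ 0 = 0" "j \<le> K"
  shows "(fps_ln 1 oo W) $ j $$ k
      = (\<Sum>n=1..K. (- 1) ^ (n - 1) / of_nat n * ((W ^ n) $ j) $$ k)"
proof -
  have eq: "(- 1) ^ (n - 1) / of_nat n = (fls_const ((- 1) ^ (n - 1) / of_nat n) :: rat fls)" for n
    by (simp add: fls_of_nat fls_const_power flip: fls_const_divide_const)
  show ?thesis
    unfolding fps_ln_compose_nth[OF assms] fls_nth_sum eq by simp
qed

text \<open>With \<open>p(x) = f(x\<^sup>2) / x\<close>, the factorisation
  \<open>1 - p(x) / p(y) = (1 + U) (1 - y / x) / f(y\<^sup>2)\<close> turns into a sum of logarithms, in which the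
  last two have no terms with a positive power of \<open>x\<close>.\<close>

lemma log_kernel_coeff:
  fixes T :: "nat \<Rightarrow> rat" and M i j K :: nat
  defines "f \<equiv> 1 - (\<Sum>g=1..M. fps_const (T g) * fps_X ^ g)"
    and "U \<equiv> \<Sum>g=1..M. fps_const (fls_const (T g)) * pair_kernel g"
  assumes i: "i \<ge> 1" and j: "j \<le> K"
  shows "(\<Sum>n=1..K. (- 1) ^ (n - 1) / of_nat n * ((U ^ n) $ j) $$ int i)
    = - (\<Sum>n=1..K. 1 / of_nat n * ((f ^ n oo fps_X ^ 2) $ (i + n))
          * (if n \<le> j then (inverse f ^ n oo fps_X ^ 2) $ (j - n) else 0))"
proof -
  let ?x = "fps_const fls_X :: rat fls fps" and ?xi = "fps_const (inverse fls_X) :: rat fls fps"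
  define h where "h = f oo fps_X ^ 2"
  have X2: "(fps_X ^ 2 :: rat fps) $ 0 = 0" by simp
  have f0: "f $ 0 = 1" by (simp add: f_def fps_sum_nth)
  have h0: "h $ 0 = 1" by (simp add: h_def f0)
  have h: "h = 1 - (\<Sum>g=1..M. fps_const (T g) * fps_X ^ (2 * g))"
    by (simp add: h_def f_def fps_compose_sub_distrib fps_compose_sum_distrib
        fps_const_mult_apply_left[symmetric] fps_compose_power[OF X2, symmetric] power_mult)
  define a :: "rat fls fps" where "a = fps_const (fps_to_fls h)"
  define b where "b = lift_y h"
  define bi where "bi = lift_y (inverse h)"
  have bbi: "b * bi = 1"
    using lift_y_mult[of h "inverse h"] h0
    by (simp add: b_def bi_def lift_y_1 inverse_mult_eq_1')
  have a: "a = 1 - (\<Sum>g=1..M. fps_const (fls_const (T g)) * fps_const (fls_X ^ (2 * g)))"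
    by (simp add: a_def h fps_to_fls_sum fls_times_fps_to_fls fps_to_fls_power fps_const_sum
        flip: fps_const_sub fps_const_mult)
  have b: "b = 1 - (\<Sum>g=1..M. fps_const (fls_const (T g)) * fps_X ^ (2 * g))"
    by (rule fps_ext)
      (simp add: b_def lift_y_nth h fps_sum_nth fls_const_sum fps_X_power_nth if_distrib
        cong: if_cong flip: fls_const_mult_const)
  \<comment> \<open>With p(x) = h(x)/x, the left side is x y (p(y) - p(x)).\<close>
  have key: "?x * b - fps_X * a = (?x - fps_X) * (1 + U)"
  proof -
    have "(?x - fps_X) * U = (\<Sum>g=1..M. fps_const (fls_const (T g)) * ((?x - fps_X) * pair_kernel g))"
      by (simp add: U_def sum_distrib_left mult_ac)
    also have "\<dots> = (\<Sum>g=1..M. fps_const (fls_const (T g)) *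
        (fps_const (fls_X ^ (2 * g)) * fps_X - ?x * fps_X ^ (2 * g)))"
      by (intro sum.cong refl) (simp add: pair_kernel_identity)
    finally show ?thesis
      by (simp add: a b ring_distribs sum_subtractf sum_distrib_left sum_distrib_right mult_ac
          del: fps_const_mult fls_const_mult_const)
  qed
  have xix: "?xi * ?x = 1" by (simp add: fps_const_mult)
  \<comment> \<open>\<open>A\<close> is - p(x)/p(y). The division by x is the reason for Laurent
    series as coefficients.\<close>
  define A where "A = - (fps_X * bi * (?xi * a))"
  define Y where "Y = - (?xi * fps_X)"
  have U0: "U $ 0 = 0"
    by (simp add: U_def pair_kernel_def fps_sum_nth)
  have bi0: "(bi - 1) $ 0 = 0"
    by (simp add: bi_def lift_y_def h0)
  have Y0: "Y $ 0 = 0" by (simp add: Y_def)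
  have A0: "A $ 0 = 0" by (simp add: A_def)
  have "1 + A = ?xi * bi * (?x * b - fps_X * a)"
  proof -
    have "?xi * bi * (?x * b - fps_X * a) = (?xi * ?x) * (b * bi) + A"
      by (simp add: A_def algebra_simps del: fps_const_mult)
    then show ?thesis by (simp add: xix bbi)
  qed
  also have "\<dots> = (1 + U) * (1 + Y) * bi"
  proof -
    have "?xi * bi * ((?x - fps_X) * (1 + U)) = (?xi * ?x - ?xi * fps_X) * (1 + U) * bi"
      by (simp only: algebra_simps)
    then show ?thesis unfolding key by (simp only: xix Y_def) (simp add: mult_ac)
  qed
  finally have fact: "1 + A = (1 + U) * (1 + Y) * bi" .
  have UY0: "((1 + U) * (1 + Y) - 1) $ 0 = 0"
    by (simp add: U0 Y0)
  have "(1 + ((1 + U) * (1 + Y) - 1)) * (1 + (bi - 1)) - 1 = A"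
    by (simp only: add.commute[of 1 "_ - 1"] diff_add_cancel fact[symmetric]) simp
  then have "fps_ln 1 oo A = fps_ln 1 oo ((1 + ((1 + U) * (1 + Y) - 1)) * (1 + (bi - 1)) - 1)"
    by simp
  also have "\<dots> = (fps_ln 1 oo U) + (fps_ln 1 oo Y) + (fps_ln 1 oo (bi - 1))"
    by (simp only: fps_ln_compose_mult[OF UY0 bi0] fps_ln_compose_mult[OF U0 Y0])
  finally have logs: "fps_ln 1 oo U = (fps_ln 1 oo A) - (fps_ln 1 oo Y) - (fps_ln 1 oo (bi - 1))"
    by simp
  have Yz: "((Y ^ n) $ j) $$ int i = 0" for n
  proof -
    have "Y = fps_const (- fls_X_inv) * fps_X"
      by (simp add: Y_def fls_inverse_X flip: fps_const_neg)
    then have "Y ^ n = fps_const ((- fls_X_inv) ^ n) * fps_X ^ n"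
      by (simp only: power_mult_distrib fps_const_power)
    then show ?thesis
      using i by (cases "even n") (simp_all add: fps_X_power_mult_right_nth)
  qed
  have bz: "(((bi - 1) ^ n) $ j) $$ int i = 0" for n
  proof -
    have "bi - 1 = lift_y (inverse h - 1)"
      by (rule fps_ext) (simp add: bi_def lift_y_nth h0)
    then show ?thesis
      using i by (simp add: lift_y_nth flip: lift_y_power)
  qed
  have An: "((A ^ n) $ j) $$ int i = (-1) ^ n * ((f ^ n oo fps_X ^ 2) $ (i + n))
          * (if n \<le> j then (inverse f ^ n oo fps_X ^ 2) $ (j - n) else 0)" for n
  proof -
    have hp: "h ^ n = f ^ n oo fps_X ^ 2" "inverse h ^ n = inverse f ^ n oo fps_X ^ 2"
      using fps_inverse_compose[OF X2, of f]
      by (simp_all add: h_def f0 flip: fps_compose_power[OF X2])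
    have "A = fps_const (- (fls_X_inv * fps_to_fls h)) * (lift_y (inverse h) * fps_X)"
      by (simp add: A_def bi_def a_def fls_inverse_X mult_ac flip: fps_const_neg fps_const_mult)
    then have "A ^ n = fps_const ((- (fls_X_inv * fps_to_fls h)) ^ n) * (lift_y (inverse h ^ n) * fps_X ^ n)"
      by (simp only: power_mult_distrib fps_const_power lift_y_power)
    then have "(A ^ n) $ j = (if n \<le> j
        then (- (fls_X_inv * fps_to_fls h)) ^ n * fls_const ((inverse h ^ n) $ (j - n)) else 0)"
      by (simp add: fps_X_power_mult_right_nth lift_y_nth)
    moreover have "((- (fls_X_inv * fps_to_fls h)) ^ n) $$ int i = (-1) ^ n * (h ^ n) $ (i + n)"
      by (cases "even n")
        (simp_all add: power_mult_distrib fls_X_inv_power_times_conv_shift nat_add_distrib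
          flip: fps_to_fls_power)
    ultimately show ?thesis
      by (simp add: hp)
  qed
  have "(\<Sum>n=1..K. (- 1) ^ (n - 1) / of_nat n * ((U ^ n) $ j) $$ int i)
      = (\<Sum>n=1..K. (- 1) ^ (n - 1) / of_nat n * ((A ^ n) $ j) $$ int i)"
    unfolding fps_ln_compose_nth_nth[OF U0 j, symmetric] logs
    by (simp add: fps_ln_compose_nth_nth[OF A0 j] fps_ln_compose_nth_nth[OF Y0 j]
        fps_ln_compose_nth_nth[OF bi0 j] Yz bz)
  also have "\<dots> = - (\<Sum>n=1..K. 1 / of_nat n * ((f ^ n oo fps_X ^ 2) $ (i + n))
          * (if n \<le> j then (inverse f ^ n oo fps_X ^ 2) $ (j - n) else 0))"
    unfolding sum_negf[symmetric]
  proof (intro sum.cong refl)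
    fix n assume "n \<in> {1..K}"
    then have sign: "(- 1 :: rat) ^ (n - 1) * (- 1) ^ n = - 1"
      by (cases n) (auto simp flip: power_mult_distrib)
    let ?R = "1 / of_nat n * ((f ^ n oo fps_X ^ 2) $ (i + n))
          * (if n \<le> j then (inverse f ^ n oo fps_X ^ 2) $ (j - n) else 0)"
    have "(- 1) ^ (n - 1) / of_nat n * ((A ^ n) $ j) $$ int i = (- 1) ^ (n - 1) * (- 1) ^ n * ?R"
      unfolding An by simp
    then show "(- 1) ^ (n - 1) / of_nat n * ((A ^ n) $ j) $$ int i = - ?R"
      unfolding sign by simp
  qed
  finally show ?thesis .
qed

section \<open>Counting pairs of tuples with the kernel\<close>

lemma finite_P_hat_set:
  "finite {(is, js). length is = length gs \<and> length js = length gs \<and>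
     (\<forall>k<length gs. is ! k \<ge> 1 \<and> js ! k \<ge> 1 \<and> is ! k + js ! k = gs ! k + 1) \<and>
     sum_list is = i \<and> sum_list js = (j::nat)}" (is "finite ?S")
proof (rule finite_subset)
  show "?S \<subseteq> {xs. set xs \<subseteq> {..i} \<and> length xs = length gs}
      \<times> {xs. set xs \<subseteq> {..j} \<and> length xs = length gs}"
    using member_le_sum_list by fastforce
  show "finite ({xs. set xs \<subseteq> {..i} \<and> length xs = length gs}
      \<times> {xs. set xs \<subseteq> {..j} \<and> length xs = length gs})"
    by (intro finite_cartesian_product finite_lists_length_eq) auto
qed

lemma P_hat_Nil: "P_hat i j [] = (if i = 0 \<and> j = 0 then 1 else 0)"
proof -
  have "{(is, js). length is = length [] \<and> length js = length [] \<and>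
     (\<forall>k<length []. is ! k \<ge> 1 \<and> js ! k \<ge> 1 \<and> is ! k + js ! k = [] ! k + 1) \<and>
     sum_list is = i \<and> sum_list js = (j::nat)} = (if i = 0 \<and> j = 0 then {([], [])} else {})"
    by auto
  then show ?thesis by (simp add: P_hat_def)
qed

text \<open>The head l of the second tuple forces the head g + 1 - l of the first; the guards
  exclude the cases where subtraction would truncate.\<close>

lemma P_hat_Cons:
  "P_hat i j (g # gs) = (\<Sum>l=1..g. if g + 1 - l \<le> i \<and> l \<le> j
     then P_hat (i - (g + 1 - l)) (j - l) gs else 0)"
proof -
  define S where "S i j gs = {(is, js). length is = length gs \<and> length js = length gs \<and>
     (\<forall>k<length gs. is ! k \<ge> 1 \<and> js ! k \<ge> 1 \<and> is ! k + js ! k = gs ! k + 1) \<and>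
     sum_list is = i \<and> sum_list js = (j::nat)}" for i j gs
  have fin: "finite (S i j gs)" for i j gs
    unfolding S_def by (rule finite_P_hat_set)
  have card: "P_hat i j gs = card (S i j gs)" for i j gs
    by (simp add: P_hat_def S_def)
  define h where "h l = (\<lambda>(is, js). ((g + 1 - l) # is, l # js))" for l
  define A where "A l = (if g + 1 - l \<le> i \<and> l \<le> j
     then h l ` S (i - (g + 1 - l)) (j - l) gs else {})" for l
  have "S i j (g # gs) = (\<Union>l\<in>{1..g}. A l)"
  proof (intro equalityI subsetI)
    fix p assume p: "p \<in> S i j (g # gs)"
    then obtain a "is" b js where p_eq: "p = (a # is, b # js)"
      by (auto simp: S_def length_Suc_conv)
    from p have *: "a \<ge> 1" "b \<ge> 1" "a + b = g + 1" "a + sum_list is = i" "b + sum_list js = j"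
      "length is = length gs" "length js = length gs"
      "\<forall>k<length gs. is ! k \<ge> 1 \<and> js ! k \<ge> 1 \<and> is ! k + js ! k = gs ! k + 1"
      by (auto simp: S_def p_eq All_less_Suc2)
    then have "a = g + 1 - b" "(is, js) \<in> S (i - (g + 1 - b)) (j - b) gs"
      by (auto simp: S_def)
    moreover from this have "p = h b (is, js)" by (simp add: h_def p_eq)
    ultimately have "p \<in> A b" using * by (auto simp: A_def)
    with * show "p \<in> (\<Union>l\<in>{1..g}. A l)" by auto
  next
    fix p assume "p \<in> (\<Union>l\<in>{1..g}. A l)"
    then obtain l "is" js where *: "l \<in> {1..g}" "g + 1 - l \<le> i" "l \<le> j"
      "p = ((g + 1 - l) # is, l # js)" "(is, js) \<in> S (i - (g + 1 - l)) (j - l) gs"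
      by (auto simp: A_def h_def split: if_splits)
    then show "p \<in> S i j (g # gs)"
      by (auto simp: S_def All_less_Suc2)
  qed
  moreover have "card (\<Union>l\<in>{1..g}. A l) = (\<Sum>l=1..g. card (A l))"
    by (intro card_UN_disjoint) (auto simp: A_def h_def fin)
  moreover have "card (A l) = (if g + 1 - l \<le> i \<and> l \<le> j
     then P_hat (i - (g + 1 - l)) (j - l) gs else 0)" for l
  proof -
    have "inj (h l)" by (auto simp: h_def inj_def)
    then show ?thesis by (simp add: A_def card card_image inj_on_subset)
  qed
  ultimately show ?thesis by (simp add: card)
qed

lemma pair_kernel_mult_nth:
  "((pair_kernel g * G) $ j) $$ i = (\<Sum>l=1..2*g-1. if l \<le> j then (G $ (j - l)) $$ (i - int (2 * g - l)) else 0)"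
  by (auto simp: pair_kernel_def sum_distrib_right mult.assoc fps_sum_nth fls_nth_sum fps_X_power_mult_nth
      fls_X_power_times_conv_shift intro!: sum.cong)

text \<open>Picking a monomial x^a y^b with a + b = 2g from each factor is picking a pair of entries
  for the bound (2g - 1) + 1.\<close>

lemma prod_pair_kernel_nth:
  assumes "\<forall>g\<in>set gs. g \<ge> 1"
  shows "(prod_list (map pair_kernel gs) $ j) $$ i
    = (if i \<ge> 0 then of_nat (P_hat (nat i) j (map (\<lambda>g. 2 * g - 1) gs)) else 0)"
  using assms
proof (induction gs arbitrary: i j)
  case Nil
  then show ?case by (auto simp: P_hat_Nil)
next
  case (Cons g gs)
  let ?P = "\<lambda>i j. P_hat i j (map (\<lambda>g. 2 * g - 1) gs)"
  have "(prod_list (map pair_kernel (g # gs)) $ j) $$ i = (\<Sum>l=1..2*g-1. if l \<le> j then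
      (if i - int (2 * g - l) \<ge> 0 then of_nat (?P (nat (i - int (2 * g - l))) (j - l)) else 0) else 0)"
    using Cons by (simp add: pair_kernel_mult_nth cong: if_cong)
  also have "\<dots> = (\<Sum>l=1..2*g-1. if i \<ge> 0 \<and> 2 * g - 1 + 1 - l \<le> nat i \<and> l \<le> j
      then of_nat (?P (nat i - (2 * g - 1 + 1 - l)) (j - l)) else 0)"
  proof (intro sum.cong refl)
    fix l assume l: "l \<in> {1..2*g-1}"
    then have eq: "2 * g - 1 + 1 - l = 2 * g - l" by auto
    have "nat (i - int (2 * g - l)) = nat i - (2 * g - l)" by linarith
    moreover have "i - int (2 * g - l) \<ge> 0 \<longleftrightarrow> i \<ge> 0 \<and> 2 * g - l \<le> nat i"
      by linarith
    ultimately show "(if l \<le> j then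
      (if i - int (2 * g - l) \<ge> 0 then of_nat (?P (nat (i - int (2 * g - l))) (j - l)) else 0) else 0)
      = (if i \<ge> 0 \<and> 2 * g - 1 + 1 - l \<le> nat i \<and> l \<le> j
      then of_nat (?P (nat i - (2 * g - 1 + 1 - l)) (j - l)) else (0 :: rat))"
      unfolding eq by simp
  qed
  finally show ?case
    by (simp add: P_hat_Cons if_distrib[of of_nat] cong: if_cong)
qed

section \<open>Evaluation and differentiation of multivariate polynomials\<close>

definition monom_val :: "(nat \<Rightarrow> 'a::comm_ring_1) \<Rightarrow> (nat \<Rightarrow>\<^sub>0 nat) \<Rightarrow> 'a" where
  "monom_val x m = (\<Prod>i\<in>Poly_Mapping.keys m. x i ^ Poly_Mapping.lookup m i)"

lemma monom_val_superset:
  assumes "finite A" "Poly_Mapping.keys m \<subseteq> A"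
  shows "monom_val x m = (\<Prod>i\<in>A. x i ^ Poly_Mapping.lookup m i)"
  unfolding monom_val_def using assms
  by (intro prod.mono_neutral_left) (auto simp: in_keys_iff)

lemma monom_val_add: "monom_val x (m + n) = monom_val x m * monom_val x n"
proof -
  let ?A = "Poly_Mapping.keys m \<union> Poly_Mapping.keys n"
  have "Poly_Mapping.keys (m + n) \<subseteq> ?A" by (rule Poly_Mapping.keys_add)
  then show ?thesis
    by (simp add: monom_val_superset[of ?A] lookup_add power_add prod.distrib)
qed

lemma eval_eq_sum:
  assumes "finite A" "Poly_Mapping.keys p \<subseteq> A"
  shows "eval x p = (\<Sum>m\<in>A. Poly_Mapping.lookup p m * monom_val x m)"
  unfolding eval_def monom_val_def[symmetric] using assms
  by (intro sum.mono_neutral_left) (auto simp: in_keys_iff)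

lemma eval_0 [simp]: "eval x 0 = 0"
  by (simp add: eval_def)

lemma eval_add [simp]: "eval x (p + q) = eval x p + eval x q"
proof -
  let ?A = "Poly_Mapping.keys p \<union> Poly_Mapping.keys q"
  have "Poly_Mapping.keys (p + q) \<subseteq> ?A" by (rule Poly_Mapping.keys_add)
  then show ?thesis
    by (simp add: eval_eq_sum[of ?A] lookup_add ring_distribs sum.distrib)
qed

lemma eval_sum [simp]: "eval x (sum f A) = (\<Sum>a\<in>A. eval x (f a))"
  by (induction A rule: infinite_finite_induct) auto

lemma eval_single [simp]: "eval x (Poly_Mapping.single m c) = c * monom_val x m"
  by (subst eval_eq_sum[of "{m}"]) (auto simp: lookup_single)

lemma poly_mapping_eq_sum_single:
  "p = (\<Sum>m\<in>Poly_Mapping.keys p. Poly_Mapping.single m (Poly_Mapping.lookup p m))"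
  by (rule poly_mapping_eqI) (auto simp: lookup_sum lookup_single when_def in_keys_iff)

lemma eval_mult [simp]: "eval x (p * q) = eval x p * eval x q"
proof -
  have "p * q = (\<Sum>m\<in>Poly_Mapping.keys p. \<Sum>n\<in>Poly_Mapping.keys q.
      Poly_Mapping.single (m + n) (Poly_Mapping.lookup p m * Poly_Mapping.lookup q n))"
    by (subst poly_mapping_eq_sum_single[of p], subst poly_mapping_eq_sum_single[of q])
      (simp add: sum_product mult_single)
  then have "eval x (p * q) = eval x (\<Sum>m\<in>Poly_Mapping.keys p. \<Sum>n\<in>Poly_Mapping.keys q.
      Poly_Mapping.single (m + n) (Poly_Mapping.lookup p m * Poly_Mapping.lookup q n))"
    by (rule arg_cong)
  then show ?thesis
    by (simp add: monom_val_add eval_eq_sum[of "Poly_Mapping.keys p" p]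
        eval_eq_sum[of "Poly_Mapping.keys q" q] sum_product mult_ac)
qed

lemma eval_Const [simp]: "eval x (Const c) = c"
  by (simp add: Const_def monom_val_def)

lemma eval_1 [simp]: "eval x 1 = 1"
  using eval_Const[of x 1] by (simp add: Const_def)

lemma eval_Var [simp]: "eval x (Var i) = x i"
  by (simp add: Var_def monom_val_def)

lemma eval_power [simp]: "eval x (p ^ n) = eval x p ^ n"
  by (induction n) auto

lemma eval_prod [simp]: "eval x (prod f A) = (\<Prod>a\<in>A. eval x (f a))"
  by (induction A rule: infinite_finite_induct) auto

lemma eval_set_var_zero: "eval x (set_var_zero n p) = eval (x(n := 0)) p"
proof -
  have "eval x (if i = n then 0 else Var i) = (x(n := 0)) i" for i
    by simp
  then show ?thesis
    by (simp add: set_var_zero_def subst_def eval_def[of "x(n := 0)"])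
qed

lemma lookup_pderiv:
  "Poly_Mapping.lookup (pderiv i p) m = of_nat (Poly_Mapping.lookup m i + 1)
     * Poly_Mapping.lookup p (m + Poly_Mapping.single i 1)"
proof -
  let ?e = "Poly_Mapping.single i (1::nat)"
  \<comment> \<open>Truncated subtraction leaves a monomial without the variable i unchanged, so the
    equivalence can fail there; such terms carry the factor 0.\<close>
  have eq: "of_nat (Poly_Mapping.lookup n i) * Poly_Mapping.lookup p n = 0 \<or>
      (n - ?e = m \<longleftrightarrow> n = m + ?e)" for n
  proof (cases "Poly_Mapping.lookup n i = 0")
    case False
    then have "n - ?e + ?e = n"
      by (intro poly_mapping_eqI) (auto simp: lookup_add lookup_minus lookup_single when_def)
    then show ?thesis by auto
  qed simp
  have "Poly_Mapping.lookup (pderiv i p) m = (\<Sum>n\<in>Poly_Mapping.keys p.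
      if n - ?e = m then of_nat (Poly_Mapping.lookup n i) * Poly_Mapping.lookup p n else 0)"
    by (simp add: pderiv_def lookup_sum lookup_single when_def)
  also have "\<dots> = (\<Sum>n\<in>Poly_Mapping.keys p.
      if n = m + ?e then of_nat (Poly_Mapping.lookup n i) * Poly_Mapping.lookup p n else 0)"
    using eq by (intro sum.cong refl) auto
  also have "\<dots> = of_nat (Poly_Mapping.lookup (m + ?e) i) * Poly_Mapping.lookup p (m + ?e)"
    by (auto simp: in_keys_iff)
  finally show ?thesis by (simp add: lookup_add)
qed

lemma pderiv_commute: "pderiv i (pderiv j p) = pderiv j (pderiv i p)"
  by (rule poly_mapping_eqI)
    (cases "i = j"; simp add: lookup_pderiv lookup_add lookup_single_not_eq add_ac mult_ac)

lemma pderivs_pderiv: "pderivs ks (pderiv i p) = pderiv i (pderivs ks p)"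
  by (induction ks) (auto simp: pderivs_def pderiv_commute)

text \<open>Derivatives are computed on the lines parallel to a coordinate axis, where polynomials
  restrict to univariate ones. In particular, the value of a derivative at a point depends only on
  the values of the polynomial, so identities need only be checked at rational points.\<close>

definition restrict_line :: "(nat \<Rightarrow> 'a::comm_ring_1) \<Rightarrow> nat \<Rightarrow> 'a mpoly \<Rightarrow> 'a poly" where
  "restrict_line x i p = (\<Sum>m\<in>Poly_Mapping.keys p.
     monom (Poly_Mapping.lookup p m *
       (\<Prod>k\<in>Poly_Mapping.keys m - {i}. x k ^ Poly_Mapping.lookup m k)) (Poly_Mapping.lookup m i))"

lemma monom_val_split:
  "monom_val x m = x i ^ Poly_Mapping.lookup m i *
     (\<Prod>k\<in>Poly_Mapping.keys m - {i}. x k ^ Poly_Mapping.lookup m k)"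
  by (cases "i \<in> Poly_Mapping.keys m")
    (simp_all add: monom_val_def prod.remove in_keys_iff)

lemma poly_restrict_line: "poly (restrict_line x i p) t = eval (x(i := t)) p"
  by (simp add: restrict_line_def poly_sum poly_monom eval_def monom_val_def[symmetric]
      monom_val_split[of _ _ i] mult_ac)

lemma poly_pderiv_sum: "Polynomial.pderiv (sum f A) = (\<Sum>a\<in>A. Polynomial.pderiv (f a))"
  using higher_pderiv_sum[of 1 f A] by simp

lemma eval_pderiv: "eval x (pderiv i p) = poly (Polynomial.pderiv (restrict_line x i p)) (x i)"
proof -
  let ?e = "Poly_Mapping.single i (1::nat)"
  let ?R = "\<lambda>m. \<Prod>k\<in>Poly_Mapping.keys m - {i}. x k ^ Poly_Mapping.lookup m k"
  have "of_nat (Poly_Mapping.lookup m i) * monom_val x (m - ?e)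
      = of_nat (Poly_Mapping.lookup m i) * x i ^ (Poly_Mapping.lookup m i - 1) * ?R m" for m
  proof (cases "Poly_Mapping.lookup m i = 0")
    case False
    have "Poly_Mapping.keys (m - ?e) - {i} = Poly_Mapping.keys m - {i}"
      by (auto simp: in_keys_iff lookup_minus lookup_single)
    moreover have "Poly_Mapping.lookup (m - ?e) k = Poly_Mapping.lookup m k" if "k \<noteq> i" for k
      using that by (simp add: lookup_minus lookup_single)
    ultimately show ?thesis
      by (simp add: monom_val_split[of _ _ i] lookup_minus)
  qed simp
  then show ?thesis
    by (simp add: pderiv_def restrict_line_def poly_pderiv_sum Polynomial.pderiv_monom
        poly_sum poly_monom mult_ac)
qed

context
  fixes x :: "nat \<Rightarrow> 'a::field_char_0" and i :: nat
begin

lemma restrict_line_eqI: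
  assumes "\<And>t. eval (x(i := t)) p = poly P t"
  shows "restrict_line x i p = P"
proof -
  have "poly (restrict_line x i p) = poly P"
    by (rule ext) (simp add: poly_restrict_line assms)
  then show ?thesis by (simp add: poly_eq_poly_eq_iff)
qed

lemma eval_pderiv_cong:
  assumes "\<And>t. eval (x(i := t)) p = eval (x(i := t)) q"
  shows "eval x (pderiv i p) = eval x (pderiv i q)"
  using assms by (simp add: eval_pderiv restrict_line_eqI[of p "restrict_line x i q"] poly_restrict_line)

lemma eval_pderiv_0 [simp]: "eval x (pderiv i 0) = 0"
  by (simp add: pderiv_def)

lemma eval_pderiv_add [simp]:
  "eval x (pderiv i (p + q)) = eval x (pderiv i p) + eval x (pderiv i q)"
  using restrict_line_eqI[of "p + q" "restrict_line x i p + restrict_line x i q"]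
  by (simp add: eval_pderiv poly_restrict_line Polynomial.pderiv_add)

lemma eval_pderiv_mult [simp]:
  "eval x (pderiv i (p * q)) = eval x (pderiv i p) * eval x q + eval x p * eval x (pderiv i q)"
  using restrict_line_eqI[of "p * q" "restrict_line x i p * restrict_line x i q"]
  by (simp add: eval_pderiv poly_restrict_line Polynomial.pderiv_mult)

lemma eval_pderiv_Const [simp]: "eval x (pderiv i (Const c)) = 0"
  using restrict_line_eqI[of "Const c" "[:c:]"] by (simp add: eval_pderiv)

lemma eval_pderiv_Var [simp]: "eval x (pderiv i (Var k)) = (if k = i then 1 else 0)"
proof -
  have "restrict_line x i (Var k) = (if k = i then [:0, 1:] else [:x k:])"
    by (rule restrict_line_eqI) auto
  then show ?thesis by (simp add: eval_pderiv Polynomial.pderiv_pCons)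
qed

lemma eval_pderiv_sum [simp]:
  "eval x (pderiv i (sum f A)) = (\<Sum>a\<in>A. eval x (pderiv i (f a)))"
  by (induction A rule: infinite_finite_induct) auto

end

text \<open>Derivatives in directions other than n stay inside the hyperplane x_n = 0. With n = N,
  restricting a single first derivative to t_N = 0 is enough for all later ones.\<close>

lemma eval_pderivs_cong:
  fixes p q :: "'a::field_char_0 mpoly"
  assumes "\<And>x. x n = 0 \<Longrightarrow> eval x p = eval x q" and "n \<notin> set ks" and "x n = 0"
  shows "eval x (pderivs ks p) = eval x (pderivs ks q)"
  using assms(2,3)
proof (induction ks arbitrary: x)
  case Nil
  then show ?case using assms(1) by (simp add: pderivs_def)
next
  case (Cons k ks)
  have "eval (x(k := t)) (pderivs ks p) = eval (x(k := t)) (pderivs ks q)" for t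
    using Cons by auto
  then have "eval x (pderiv k (pderivs ks p)) = eval x (pderiv k (pderivs ks q))"
    by (rule eval_pderiv_cong)
  then show ?case by (simp add: pderivs_def)
qed

lemma eval_pderivs_lincomb:
  fixes p :: "'b \<Rightarrow> 'a::field_char_0 mpoly"
  shows "eval x (pderivs ks (\<Sum>m\<in>A. Const (a m) * p m)) = (\<Sum>m\<in>A. a m * eval x (pderivs ks (p m)))"
proof (induction ks arbitrary: x)
  case Nil
  then show ?case by (simp add: pderivs_def)
next
  case (Cons k ks)
  have "eval x (pderiv k (pderivs ks (\<Sum>m\<in>A. Const (a m) * p m)))
      = eval x (pderiv k (\<Sum>m\<in>A. Const (a m) * pderivs ks (p m)))"
    by (rule eval_pderiv_cong) (simp only: Cons.IH eval_sum eval_mult eval_Const)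
  then show ?case by (simp add: pderivs_def)
qed

text \<open>\<open>\<Sum> f [g\<^sub>1, \<dots>, g\<^sub>m] t\<^bsub>c g\<^sub>1\<^esub> \<dots> t\<^bsub>c g\<^sub>m\<^esub>\<close> over all \<open>g\<^sub>1, \<dots>, g\<^sub>m \<in> A\<close>\<close>

primrec form_poly :: "nat set \<Rightarrow> (nat \<Rightarrow> nat) \<Rightarrow> (nat list \<Rightarrow> 'a) \<Rightarrow> nat \<Rightarrow> 'a::field_char_0 mpoly"
  where
    "form_poly A c f 0 = Const (f [])"
  | "form_poly A c f (Suc m) = (\<Sum>g\<in>A. Var (c g) * form_poly A c (\<lambda>l. f (g # l)) m)"

section \<open>Symmetric forms and their iterated derivatives\<close>

definition symmetric_form :: "(nat list \<Rightarrow> 'a) \<Rightarrow> bool" where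
  "symmetric_form f \<longleftrightarrow> (\<forall>l l'. mset l = mset l' \<longrightarrow> f l = f l')"

lemma symmetric_formD: "symmetric_form f \<Longrightarrow> mset l = mset l' \<Longrightarrow> f l = f l'"
  unfolding symmetric_form_def by blast

lemma symmetric_form_append: "symmetric_form f \<Longrightarrow> symmetric_form (\<lambda>l. f (l0 @ l))"
  unfolding symmetric_form_def by (metis mset_append)

lemma symmetric_form_Cons: "symmetric_form f \<Longrightarrow> symmetric_form (\<lambda>l. f (g # l))"
  using symmetric_form_append[of f "[g]"] by simp

text \<open>The derivative may hit any of the m + 1 slots; symmetry moves g to the front each time,
  so all contributions agree.\<close>

lemma eval_pderiv_form_poly:
  fixes x :: "nat \<Rightarrow> 'a::field_char_0"
  assumes "finite A" "inj_on c A" "g \<in> A" "symmetric_form f"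
  shows "eval x (pderiv (c g) (form_poly A c f (Suc m)))
    = of_nat (Suc m) * eval x (form_poly A c (\<lambda>l. f (g # l)) m)"
  using assms(4)
proof (induction m arbitrary: f)
  case 0
  have "(\<Sum>h\<in>A. (if c h = c g then 1 else 0) * f [h]) = (\<Sum>h\<in>A. if h = g then f [h] else 0)"
    using assms(2,3) by (intro sum.cong) (auto simp: inj_on_eq_iff)
  then show ?case using assms(1,3) by simp
next
  case (Suc m)
  let ?F = "\<lambda>f m. eval x (form_poly A c f m)"
  have "eval x (pderiv (c g) (form_poly A c f (Suc (Suc m))))
      = (\<Sum>h\<in>A. (if c h = c g then 1 else 0) * ?F (\<lambda>l. f (h # l)) (Suc m)
          + x (c h) * eval x (pderiv (c g) (form_poly A c (\<lambda>l. f (h # l)) (Suc m))))"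
    by (subst form_poly.simps(2)) (simp del: form_poly.simps)
  also have "\<dots> = (\<Sum>h\<in>A. (if h = g then ?F (\<lambda>l. f (h # l)) (Suc m) else 0)
          + x (c h) * (of_nat (Suc m) * ?F (\<lambda>l. f (g # h # l)) m))"
  proof (intro sum.cong refl)
    fix h assume h: "h \<in> A"
    have "(\<lambda>l. f (h # g # l)) = (\<lambda>l. f (g # h # l))"
      using Suc.prems by (intro ext symmetric_formD[of f]) auto
    then show "(if c h = c g then 1 else 0) * ?F (\<lambda>l. f (h # l)) (Suc m)
          + x (c h) * eval x (pderiv (c g) (form_poly A c (\<lambda>l. f (h # l)) (Suc m)))
        = (if h = g then ?F (\<lambda>l. f (h # l)) (Suc m) else 0)
          + x (c h) * (of_nat (Suc m) * ?F (\<lambda>l. f (g # h # l)) m)"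
      using h assms(2,3)
      by (simp add: inj_on_eq_iff Suc.IH[OF symmetric_form_Cons[OF Suc.prems]] del: form_poly.simps of_nat_Suc)
  qed
  also have "\<dots> = ?F (\<lambda>l. f (g # l)) (Suc m) + of_nat (Suc m) * ?F (\<lambda>l. f (g # l)) (Suc m)"
    using assms(1,3)
    by (simp add: sum.distrib mult.left_commute[of "x _"] del: of_nat_Suc flip: sum_distrib_left)
  finally show ?case by (simp add: algebra_simps del: form_poly.simps)
qed

lemma eval_pderivs_form_poly:
  fixes x :: "nat \<Rightarrow> 'a::field_char_0"
  assumes "finite A" "inj_on c A" "symmetric_form f" "set gs \<subseteq> A"
  shows "eval x (pderivs (map c gs) (form_poly A c f m)) = (if length gs \<le> m
    then fact m / fact (m - length gs) * eval x (form_poly A c (\<lambda>l. f (gs @ l)) (m - length gs)) else 0)"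
  using assms(4)
proof (induction gs arbitrary: x)
  case Nil
  then show ?case by (simp add: pderivs_def)
next
  case (Cons g gs)
  let ?P = "form_poly A c (\<lambda>l. f (gs @ l)) (m - length gs)"
  let ?C = "if length gs \<le> m then fact m / fact (m - length gs) else (0::'a)"
  have "eval x (pderivs (map c (g # gs)) (form_poly A c f m))
      = eval x (pderiv (c g) (pderivs (map c gs) (form_poly A c f m)))"
    by (simp add: pderivs_def)
  also have "\<dots> = eval x (pderiv (c g) (Const ?C * ?P))"
    using Cons by (intro eval_pderiv_cong) auto
  also have "\<dots> = ?C * eval x (pderiv (c g) ?P)"
    by simp
  also have "\<dots> = (if length (g # gs) \<le> m then fact m / fact (m - length (g # gs))
      * eval x (form_poly A c (\<lambda>l. f ((g # gs) @ l)) (m - length (g # gs))) else 0)"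
  proof (cases "length gs < m")
    case True
    then obtain k where k: "m - length gs = Suc k"
      by (metis Suc_diff_Suc)
    have k': "m - length (g # gs) = k" using k by simp
    have "(\<lambda>l. f (gs @ g # l)) = (\<lambda>l. f ((g # gs) @ l))"
      using assms(3) by (intro ext symmetric_formD[of f]) auto
    then have "eval x (pderiv (c g) ?P) = of_nat (Suc k) * eval x (form_poly A c (\<lambda>l. f ((g # gs) @ l)) k)"
      unfolding k using eval_pderiv_form_poly[OF assms(1,2) _ symmetric_form_append[OF assms(3)], of g x gs k]
        Cons.prems by simp
    then show ?thesis
      using True unfolding k' k by (simp add: fact_Suc del: of_nat_Suc)
  next
    case False
    then show ?thesis by (cases "length gs = m") auto
  qed
  finally show ?case .
qed

lemma eval_0_form_poly: "eval (\<lambda>_. 0) (form_poly A c f m) = (if m = 0 then f [] else 0)"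
  by (cases m) simp_all

text \<open>At the origin only the homogeneous part whose degree is the number of derivatives
  survives; the factorial counts the assignments of derivatives to slots.\<close>

lemma eval_0_pderivs_form_series:
  fixes f :: "nat list \<Rightarrow> 'a::field_char_0"
  assumes "finite A" "inj_on c A" "symmetric_form f" "set gs \<subseteq> A" "finite B" "length gs \<in> B"
  shows "eval (\<lambda>_. 0) (pderivs (map c gs) (\<Sum>m\<in>B. Const (a m) * form_poly A c f m))
    = a (length gs) * fact (length gs) * f gs"
proof -
  have "eval (\<lambda>_. 0) (pderivs (map c gs) (\<Sum>m\<in>B. Const (a m) * form_poly A c f m))
      = (\<Sum>m\<in>B. if m = length gs then a m * fact m * f gs else 0)"
    unfolding eval_pderivs_lincomb eval_pderivs_form_poly[OF assms(1-4)] eval_0_form_poly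
    by (intro sum.cong) auto
  then show ?thesis using assms(5,6) by simp
qed

lemma symmetric_form_prod_kernel:
  "symmetric_form (\<lambda>l. ((prod_list (map pair_kernel l) * G) $ j) $$ i)"
proof -
  have "prod_list (map pair_kernel l) = (\<Prod>g\<in>#mset l. pair_kernel g)" for l
    by (induction l) simp_all
  then show ?thesis by (simp add: symmetric_form_def)
qed

text \<open>This is the expansion of the m-th power of the kernel sum. The factor \<open>G\<close>
  serves the induction, which moves each peeled kernel into it.\<close>

lemma eval_form_poly_kernel:
  "eval x (form_poly A c (\<lambda>l. ((prod_list (map pair_kernel l) * G) $ j) $$ i) m)
    = ((((\<Sum>g\<in>A. fps_const (fls_const (x (c g))) * pair_kernel g) ^ m) * G) $ j) $$ i"
proof (induction m arbitrary: G)
  case 0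
  then show ?case by simp
next
  case (Suc m)
  let ?U = "\<Sum>g\<in>A. fps_const (fls_const (x (c g))) * pair_kernel g"
  have "prod_list (map pair_kernel (g # l)) * G = prod_list (map pair_kernel l) * (pair_kernel g * G)" for g l
    by (simp add: mult_ac)
  then have "eval x (form_poly A c (\<lambda>l. ((prod_list (map pair_kernel l) * G) $ j) $$ i) (Suc m))
      = (\<Sum>g\<in>A. x (c g) * (((?U ^ m) * (pair_kernel g * G)) $ j) $$ i)"
    by (simp only: form_poly.simps eval_sum eval_mult eval_Var Suc)
  also have "\<dots> = ((\<Sum>g\<in>A. fps_const (fls_const (x (c g))) * (?U ^ m * (pair_kernel g * G))) $ j) $$ i"
    by (simp add: fps_sum_nth fls_nth_sum)
  also have "(\<Sum>g\<in>A. fps_const (fls_const (x (c g))) * (?U ^ m * (pair_kernel g * G))) = ?U ^ m * (?U * G)"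
    by (simp only: sum_distrib_left sum_distrib_right mult_ac)
  also have "\<dots> = ?U ^ Suc m * G" by (simp only: power_Suc mult_ac)
  finally show ?case .
qed

section \<open>Sums over weighted exponents\<close>

text \<open>With u = p^(-2), one plus 2(N - 1) times this series is lambda / p^(2N-2); the weight N
  - k of v_k becomes its degree in u.\<close>

definition coord_series :: "nat \<Rightarrow> (nat \<Rightarrow> 'a::comm_ring_1) \<Rightarrow> 'a fps" where
  "coord_series N v = (\<Sum>k=1..N-1. fps_const (v k) * fps_X ^ (N - k))"

lemma coord_series_mult_nth:
  "(coord_series N v * G) $ w = (\<Sum>k=1..N-1. if N - k \<le> w then v k * G $ (w - (N - k)) else 0)"
  unfolding coord_series_def sum_distrib_right fps_sum_nth
  by (intro sum.cong refl) (simp add: mult.assoc fps_X_power_mult_nth)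

lemma coord_series_nth:
  "coord_series N v $ m = (if m \<in> {1..N-1} then v (N - m) else 0)"
proof -
  have "coord_series N v $ m = (\<Sum>k=1..N-1. if k = N - m \<and> m \<in> {1..N-1} then v k else 0)"
    unfolding coord_series_def fps_sum_nth
    by (intro sum.cong refl) (auto simp: fps_X_power_nth)
  then show ?thesis by (cases "m \<in> {1..N-1}") auto
qed

text \<open>The multinomial theorem with divided powers. Weighting an exponent by \<open>a k\<close>
  lowers it at k, and summing these weights over k gives its size n + 1.\<close>

lemma coord_series_power_nth_weighted:
  fixes v :: "nat \<Rightarrow> 'a::field_char_0"
  shows "(coord_series N v ^ n) $ w = fact n *
    (\<Sum>a\<in>{a\<in>weighted_exps N w. exp_size N a = n}. \<Prod>k=1..N-1. v k ^ a k / fact (a k))"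
proof (induction n arbitrary: w)
  case 0
  have "{a\<in>weighted_exps N w. exp_size N a = 0} = (if w = 0 then {\<lambda>_. 0} else {})"
  proof -
    have zero: "a = (\<lambda>_. 0)" if "a \<in> weighted_exps N w" "exp_size N a = 0" for a
    proof
      fix k show "a k = 0"
        using that by (cases "k \<in> {1..N-1}") (auto simp: weighted_exps_def exp_size_def)
    qed
    show ?thesis
    proof (cases "w = 0")
      case True
      have "(\<lambda>_. 0) \<in> {a\<in>weighted_exps N w. exp_size N a = 0}"
        by (simp add: weighted_exps_def exp_size_def True)
      then show ?thesis using zero True by auto
    next
      case False
      then have "(\<lambda>_. 0) \<notin> weighted_exps N w"
        by (simp add: weighted_exps_def)
      then show ?thesis using zero False by auto
    qed
  qed
  then show ?case by simp
next
  case (Suc n)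
  let ?A = "\<lambda>n w. {a\<in>weighted_exps N w. exp_size N a = n}"
  let ?d = "\<lambda>a. \<Prod>k=1..N-1. v k ^ a k / fact (a k)"
  have fin: "finite (?A n w)" for n w
    using finite_weighted_exps by simp
  have step: "(\<Sum>a\<in>?A (Suc n) w. of_nat (a k) * ?d a)
      = (if N - k \<le> w then v k * (\<Sum>a\<in>?A n (w - (N - k)). ?d a) else 0)"
    if k: "k \<in> {1..N-1}" for k
  proof -
    let ?up = "\<lambda>a::nat\<Rightarrow>nat. a(k := Suc (a k))"
    have sum_up: "(\<Sum>l=1..N-1. c l * ?up a l) = c k + (\<Sum>l=1..N-1. c l * a l)" for a and c :: "nat \<Rightarrow> nat"
    proof -
      have "(\<Sum>l=1..N-1. c l * ?up a l) = (\<Sum>l=1..N-1. (if l = k then c l else 0) + c l * a l)"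
        by (intro sum.cong) auto
      then show ?thesis using k by (simp add: sum.distrib)
    qed
    have size_up: "exp_size N (?up a) = Suc (exp_size N a)" for a
      using sum_up[of "\<lambda>_. 1"] by (simp add: exp_size_def)
    have d_up: "of_nat (?up a k) * ?d (?up a) = v k * ?d a" for a
      using k by (simp add: prod.remove[of _ k] fact_Suc del: of_nat_Suc)
    show ?thesis
    proof (cases "N - k \<le> w")
      case True
      have bij: "?up ` ?A n (w - (N - k)) = {a\<in>?A (Suc n) w. a k \<noteq> 0}"
      proof (intro equalityI subsetI)
        fix a assume "a \<in> ?up ` ?A n (w - (N - k))"
        then obtain b where b: "b \<in> ?A n (w - (N - k))" "a = ?up b" by auto
        then show "a \<in> {a\<in>?A (Suc n) w. a k \<noteq> 0}"
          using True k size_up[of b] sum_up[of "\<lambda>k. N - k" b]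
          by (auto simp: weighted_exps_def)
      next
        fix a assume a: "a \<in> {a\<in>?A (Suc n) w. a k \<noteq> 0}"
        define b where "b = a(k := a k - 1)"
        have ab: "a = ?up b" using a by (auto simp: b_def)
        have "b \<in> ?A n (w - (N - k))"
          using a k size_up[of b] sum_up[of "\<lambda>k. N - k" b] unfolding ab[symmetric]
          by (auto simp: weighted_exps_def b_def)
        then show "a \<in> ?up ` ?A n (w - (N - k))" using ab by blast
      qed
      have inj: "inj_on ?up (?A n (w - (N - k)))"
      proof (rule inj_onI)
        fix a b assume eq: "?up a = ?up b"
        show "a = b"
        proof
          fix l show "a l = b l" using fun_cong[OF eq, of l] by (cases "l = k") auto
        qed
      qed
      have "(\<Sum>a\<in>?A (Suc n) w. of_nat (a k) * ?d a)
          = (\<Sum>a\<in>{a\<in>?A (Suc n) w. a k \<noteq> 0}. of_nat (a k) * ?d a)"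
        using fin by (intro sum.mono_neutral_right) auto
      also have "\<dots> = (\<Sum>a\<in>?A n (w - (N - k)). of_nat (?up a k) * ?d (?up a))"
        unfolding bij[symmetric] sum.reindex[OF inj] by simp
      finally show ?thesis
        using True unfolding d_up by (simp add: sum_distrib_left)
    next
      case False
      have "a k = 0" if "a \<in> weighted_exps N w" for a
      proof (rule ccontr)
        assume "a k \<noteq> 0"
        then have "N - k \<le> (N - k) * a k" by simp
        also have "\<dots> \<le> (\<Sum>l=1..N-1. (N - l) * a l)"
          by (rule member_le_sum[OF k]) auto
        finally show False using that False by (simp add: weighted_exps_def)
      qed
      then show ?thesis using False by (auto intro: sum.neutral)
    qed
  qed
  have "of_nat (Suc n) * (\<Sum>a\<in>?A (Suc n) w. ?d a)
      = (\<Sum>a\<in>?A (Suc n) w. (\<Sum>k=1..N-1. of_nat (a k)) * ?d a)"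
    by (auto simp: sum_distrib_left exp_size_def simp flip: of_nat_sum of_nat_Suc intro!: sum.cong)
  also have "\<dots> = (\<Sum>k=1..N-1. \<Sum>a\<in>?A (Suc n) w. of_nat (a k) * ?d a)"
    unfolding sum_distrib_right by (rule sum.swap)
  also have "\<dots> = (\<Sum>k=1..N-1. if N - k \<le> w then v k * (\<Sum>a\<in>?A n (w - (N - k)). ?d a) else 0)"
    by (intro sum.cong refl step)
  finally have "fact (Suc n) * (\<Sum>a\<in>?A (Suc n) w. ?d a) = fact n *
      (\<Sum>k=1..N-1. if N - k \<le> w then v k * (\<Sum>a\<in>?A n (w - (N - k)). ?d a) else 0)"
    by (simp add: fact_Suc del: of_nat_Suc)
  then show ?case
    by (simp add: coord_series_mult_nth Suc sum_distrib_left if_distrib mult_ac cong: if_cong)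
qed

lemma exp_size_le:
  assumes "a \<in> weighted_exps N w"
  shows "exp_size N a \<le> w"
proof -
  have "exp_size N a \<le> (\<Sum>k=1..N-1. (N - k) * a k)"
    unfolding exp_size_def by (intro sum_mono) auto
  with assms show ?thesis by (simp add: weighted_exps_def)
qed

text \<open>The common shape of \<open>t_of_v\<close> and \<open>dF_of_v\<close>: their coefficients
  depend on an exponent only through its size, so the sums collapse to powers of
  \<open>coord_series\<close>.\<close>

definition weighted_poly :: "nat \<Rightarrow> (nat \<Rightarrow> rat mpoly) \<Rightarrow> nat \<Rightarrow> (nat \<Rightarrow> rat) \<Rightarrow> rat mpoly" where
  "weighted_poly N v w C = (\<Sum>a\<in>weighted_exps N w. Const (C (exp_size N a)) * divided_monom N v a)"

lemma eval_weighted_poly: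
  "eval x (weighted_poly N v w C)
    = (\<Sum>n=0..w. C n / fact n * (coord_series N (\<lambda>k. eval x (v k)) ^ n) $ w)"
proof -
  let ?d = "\<lambda>a. \<Prod>k=1..N-1. eval x (v k) ^ a k / fact (a k)"
  have "eval x (weighted_poly N v w C) = (\<Sum>a\<in>weighted_exps N w. C (exp_size N a) * ?d a)"
    by (simp add: weighted_poly_def divided_monom_def)
  also have "\<dots> = (\<Sum>n=0..w. \<Sum>a\<in>{a\<in>weighted_exps N w. exp_size N a = n}. C (exp_size N a) * ?d a)"
    by (rule sum.group[symmetric]) (auto simp: finite_weighted_exps exp_size_le)
  also have "\<dots> = (\<Sum>n=0..w. C n * (\<Sum>a\<in>{a\<in>weighted_exps N w. exp_size N a = n}. ?d a))"
    by (simp add: sum_distrib_left)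
  finally show ?thesis
    by (simp add: coord_series_power_nth_weighted)
qed

lemma eval_coord_series_power:
  "eval x ((coord_series N v ^ n) $ w) = (coord_series N (\<lambda>k. eval x (v k)) ^ n) $ w"
proof (induction n arbitrary: w)
  case 0
  then show ?case by (cases w) auto
next
  case (Suc n)
  then show ?case by (simp add: coord_series_mult_nth if_distrib cong: if_cong)
qed

lemma eval_pderiv_coord_series_power:
  fixes v :: "nat \<Rightarrow> 'a::field_char_0 mpoly"
  shows "eval x (pderiv i ((coord_series N v ^ Suc n) $ w)) = of_nat (Suc n) *
    (coord_series N (\<lambda>k. eval x (v k)) ^ n * coord_series N (\<lambda>k. eval x (pderiv i (v k)))) $ w"
proof (induction n arbitrary: w)
  case 0
  have "eval x (pderiv i (coord_series N v $ w)) = coord_series N (\<lambda>k. eval x (pderiv i (v k))) $ w"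
    by (simp add: coord_series_nth)
  then show ?case by simp
next
  case (Suc n)
  let ?V = "coord_series N (\<lambda>k. eval x (v k))"
  let ?D = "coord_series N (\<lambda>k. eval x (pderiv i (v k)))"
  have "eval x (pderiv i ((coord_series N v ^ Suc (Suc n)) $ w))
      = eval x (pderiv i ((coord_series N v * coord_series N v ^ Suc n) $ w))"
    by simp
  also have "\<dots> = (\<Sum>k=1..N-1. if N - k \<le> w
      then eval x (pderiv i (v k)) * (?V ^ Suc n) $ (w - (N - k)) else 0)
    + (\<Sum>k=1..N-1. if N - k \<le> w
      then eval x (v k) * (of_nat (Suc n) * (?V ^ n * ?D) $ (w - (N - k))) else 0)"
    unfolding coord_series_mult_nth
    by (auto simp: Suc eval_coord_series_power simp del: power_Suc of_nat_Suc
        simp flip: sum.distrib intro!: sum.cong)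
  also have "\<dots> = (?D * ?V ^ Suc n) $ w + of_nat (Suc n) * (?V * (?V ^ n * ?D)) $ w"
    unfolding coord_series_mult_nth[of _ _ "?V ^ Suc n"] coord_series_mult_nth[of _ _ "?V ^ n * ?D"]
    by (simp add: sum_distrib_left if_distrib mult_ac cong: if_cong del: power_Suc of_nat_Suc)
  also have "\<dots> = of_nat (Suc (Suc n)) * (?V ^ Suc n * ?D) $ w"
    by (simp add: algebra_simps)
  finally show ?case .
qed

text \<open>The chain rule for V^n / n!, which lowers n by one; hence the index shift in
  \<open>C\<close>.\<close>

lemma eval_pderiv_weighted_poly:
  "eval x (pderiv i (weighted_poly N v w C)) = (\<Sum>n<w. C (Suc n) / fact n *
     (coord_series N (\<lambda>k. eval x (v k)) ^ n * coord_series N (\<lambda>k. eval x (pderiv i (v k)))) $ w)"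
proof -
  have "eval x (pderiv i (weighted_poly N v w C))
      = eval x (pderiv i (\<Sum>n=0..w. Const (C n / fact n) * (coord_series N v ^ n) $ w))"
    by (rule eval_pderiv_cong) (simp add: eval_weighted_poly eval_coord_series_power)
  also have "\<dots> = (\<Sum>n=0..w. C n / fact n * eval x (pderiv i ((coord_series N v ^ n) $ w)))"
    by simp
  also have "\<dots> = C 0 / fact 0 * eval x (pderiv i (1 $ w))
      + (\<Sum>n<w. C (Suc n) / fact (Suc n) * eval x (pderiv i ((coord_series N v ^ Suc n) $ w)))"
    by (simp add: atLeast0AtMost sum.atMost_shift del: fact_Suc power_Suc)
  also have "eval x (pderiv i (1 $ w)) = 0"
    by (cases w) (use eval_pderiv_Const[of x i 1] in \<open>auto simp: Const_def\<close>)
  finally show ?thesis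
    unfolding eval_pderiv_coord_series_power by (simp add: fact_Suc del: of_nat_Suc)
qed

section \<open>Second derivatives of the potential\<close>

text \<open>Turns the signed products of both defining formulas into binomial coefficients with
  rational upper entry, hence the sums into coefficients of (1 + c V)^r.\<close>

lemma prod_arith_progression:
  fixes c r :: "'a::field_char_0"
  shows "(- 1) ^ n * (\<Prod>k<n. of_nat k * c - c * r) = c ^ n * fact n * (r gchoose n)"
proof (induction n)
  case (Suc n)
  have "(- 1) ^ Suc n * (\<Prod>k<Suc n. of_nat k * c - c * r)
      = ((- 1) ^ n * (\<Prod>k<n. of_nat k * c - c * r)) * (c * (r - of_nat n))"
    by (simp add: algebra_simps)
  also have "\<dots> = c ^ Suc n * fact n * ((r gchoose n) * (r - of_nat n))"
    unfolding Suc by (simp add: mult_ac)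
  also have "(r gchoose n) * (r - of_nat n) = of_nat (Suc n) * (r gchoose Suc n)"
    using gbinomial_mult_1[of r n] by (simp add: algebra_simps)
  finally show ?case by (simp add: fact_Suc mult_ac del: of_nat_Suc)
qed simp

text \<open>For V the coordinate series and c = 2(N - 1), (1 + c V)^(j/c) is (z/p)^j, with
  logarithmic derivative j u V' / (1 + c V).\<close>

lemma series_powers_binomial:
  fixes c :: "'a::field_char_0" and V :: "'a fps"
  assumes "c \<noteq> 0" "V $ 0 = 0"
  shows "series_powers (\<lambda>j. fps_binomial (j / c) oo (fps_const c * V))
     (fps_X * (inverse (1 + fps_const c * V) * fps_deriv V))"
proof
  let ?U = "fps_const c * V"
  have U: "?U $ 0 = 0" using assms by simp
  fix a b :: 'a
  show "fps_binomial ((a + b) / c) oo ?U = (fps_binomial (a / c) oo ?U) * (fps_binomial (b / c) oo ?U)"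
    by (simp add: add_divide_distrib fps_binomial_add_mult fps_compose_mult_distrib[OF U])
  show "(fps_binomial (a / c) oo ?U) $ 0 = 1"
    by simp
  fix m
  let ?W = "fps_binomial (a / c) oo ?U"
  have "fps_deriv ?W = (fps_deriv (fps_binomial (a / c)) oo ?U) * fps_deriv ?U"
    by (rule fps_compose_deriv[OF U])
  also have "fps_deriv (fps_binomial (a / c)) = fps_const (a / c) * fps_binomial (a / c) * inverse (1 + fps_X)"
    unfolding fps_binomial_deriv by (rule fps_divide_unit) simp
  also have "\<dots> oo ?U = fps_const (a / c) * ?W * inverse (1 + ?U)"
    by (simp add: fps_compose_mult_distrib[OF U] fps_inverse_compose[OF U] fps_compose_add_distrib
        fps_X_fps_compose_startby0[OF U])
  also have "\<dots> * fps_deriv ?U = fps_const (a / c) * fps_const c * (?W * (inverse (1 + ?U) * fps_deriv V))"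
    by (simp add: mult_ac del: fps_const_mult)
  also have "fps_const (a / c) * fps_const c = fps_const a"
    using assms by simp
  finally have deriv: "fps_deriv ?W = fps_const a * (?W * (inverse (1 + ?U) * fps_deriv V))" .
  have "of_nat m * ?W $ m = (fps_X * fps_deriv ?W) $ m"
    by (simp add: fps_mult_fps_X_deriv_shift)
  also have "\<dots> = a * (?W * (fps_X * (inverse (1 + ?U) * fps_deriv V))) $ m"
    unfolding deriv by (simp add: mult.left_commute[of fps_X] del: fps_mult_left_const_nth)
      (simp add: mult.left_commute)
  finally show "of_nat m * ?W $ m = a * (?W * (fps_X * (inverse (1 + ?U) * fps_deriv V))) $ m" .
qed

section \<open>Truncated series and the residue formula for second derivatives\<close>

lemma fps_power_nth_cong:
  fixes f g :: "'a::comm_semiring_1 fps"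
  assumes "\<And>m. m < N \<Longrightarrow> f $ m = g $ m" and "m < N"
  shows "(f ^ n) $ m = (g ^ n) $ m"
  using assms(2)
proof (induction n arbitrary: m)
  case (Suc n)
  then show ?case by (auto simp: fps_mult_nth assms(1) intro!: sum.cong)
qed simp

lemma fps_inverse_nth_cong:
  fixes f g :: "'a::field fps"
  assumes "\<And>m. m < N \<Longrightarrow> f $ m = g $ m" and "f $ 0 \<noteq> 0" "g $ 0 \<noteq> 0" and "m < N"
  shows "inverse f $ m = inverse g $ m"
proof -
  have "inverse f - inverse g = (g - f) * (inverse f * inverse g)"
  proof -
    have "(g - f) * (inverse f * inverse g)
        = (g * inverse g) * inverse f - (f * inverse f) * inverse g"
      by (simp add: algebra_simps)
    then show ?thesis using assms(2,3) by (simp add: inverse_mult_eq_1')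
  qed
  then have "(inverse f - inverse g) $ m = ((g - f) * (inverse f * inverse g)) $ m"
    by simp
  also have "\<dots> = 0"
    using assms(1,4) unfolding fps_mult_nth by (intro sum.neutral) auto
  finally show ?thesis by simp
qed

text \<open>\<open>W m\<close> changes with the coefficient index and cannot be cancelled as a
  series, but its constant term 1 makes the linear system unitriangular.\<close>

lemma fps_mult_cancel_low_order:
  fixes A E F :: "'a::comm_ring_1 fps"
  assumes eq: "\<And>m. m < N \<Longrightarrow> (W m * E) $ m = (W m * F) $ m"
    and W: "\<And>m. W m $ 0 = 1" and "m < N"
  shows "E $ m = F $ m"
  using assms(3)
proof (induction m rule: less_induct)
  case (less m)
  have split: "(W m * G) $ m = G $ m + (\<Sum>i=1..m. W m $ i * G $ (m - i))" for G
    by (simp add: fps_mult_nth sum.atLeast_Suc_atMost W)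
  have "(\<Sum>i=1..m. W m $ i * E $ (m - i)) = (\<Sum>i=1..m. W m $ i * F $ (m - i))"
    using less by (intro sum.cong refl arg_cong2[of _ _ _ _ "(*)"]) auto
  then show ?case using eq[OF less.prems] unfolding split by simp
qed

text \<open>Here \<open>T m\<close> is t_(N-m) and \<open>E\<close> collects the derivatives of the
  v_k along t_\<beta>; the assumptions on them are the formula for t and its derivative. The left
  side is the residue of z^i d(z^j)_+ divided by i j.\<close>

lemma second_derivative_coeff:
  fixes T :: "nat \<Rightarrow> rat" and E :: "rat fps"
  assumes "series_powers W ell"
    and \<alpha>: "\<alpha> \<ge> 1" and \<beta>: "\<beta> \<ge> 1" and \<alpha>\<beta>: "\<alpha> + \<beta> \<le> N" and K: "2 * \<beta> - 1 \<le> K"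
    and T: "\<And>m. m \<in> {1..N-1} \<Longrightarrow> W (2 * of_nat m - 1) $ m = (2 * of_nat m - 1) * T m"
    and E: "\<And>m. m \<in> {1..N-1} \<Longrightarrow> (W (2 * of_nat m - 1 - 2 * (of_nat N - 1)) * E) $ m
        = (if m = N - \<beta> then 1 else 0)"
    and E_0: "E $ 0 = 0" and E_high: "\<And>m. m \<ge> N \<Longrightarrow> E $ m = 0"
  shows "(W (2 * of_nat \<alpha> - 1) * E) $ (N - 1 + \<alpha>) / (2 * of_nat \<alpha> - 1)
    = (\<Sum>n=1..K. (- 1) ^ (n - 1) / of_nat n *
        (((\<Sum>g=1..N-1. fps_const (fls_const (T g)) * pair_kernel g) ^ n) $ (2 * \<beta> - 1)) $$ int (2 * \<alpha> - 1))"
proof -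
  interpret series_powers W ell by fact
  define i j :: rat where "i = 2 * of_nat \<alpha> - 1" and "j = 2 * of_nat \<beta> - 1"
  have nz: "2 * of_nat k - (1::rat) \<noteq> 0" for k
  proof
    assume "2 * of_nat k - (1::rat) = 0"
    then have "of_nat (2 * k) = (of_nat 1 :: rat)" by simp
    then have "2 * k = 1" by (simp only: of_nat_eq_iff)
    then show False by presburger
  qed
  obtain f where f0: "f $ 0 = 1" and
    f: "\<And>n m. (2 * of_nat m - of_nat n) * (f ^ n) $ m = - of_nat n * W (2 * of_nat m - of_nat n) $ m" and
    fi: "\<And>n m. (2 * of_nat m + of_nat n) * (inverse f ^ n) $ m = of_nat n * W (2 * of_nat m + of_nat n) $ m"
    by (rule inverse_series_exists) (rule that; assumption)

  define b where "b = N - \<beta>"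
  have b: "b \<ge> 1" "b + \<beta> = N" using \<alpha> \<alpha>\<beta> by (auto simp: b_def)
  \<comment> \<open>Times p^(2N-2) this is d(z^j)/dp divided by j. Powers u^m with m < N give the
    nonnegative powers of p, so agreement with \<open>E\<close> below N identifies \<open>E\<close>
    with the polynomial part.\<close>
  define E' where "E' = Abs_fps (\<lambda>m. if b \<le> m then (j - 2 * of_nat (m - b)) / j * W j $ (m - b) else 0)"
  have E': "(W (2 * of_nat m - 1 - 2 * (of_nat N - 1)) * E') $ m = (if m = b then 1 else 0)" for m
  proof (cases "b \<le> m")
    case False
    then show ?thesis by (subst mult.commute) (auto simp: fps_mult_nth E'_def)
  next
    case True
    define e where "e = m - b"
    have m: "m = e + b" using True by (simp add: e_def)
    have "2 * of_nat m - 1 - 2 * (of_nat N - 1) = 2 * of_nat e - j"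
      unfolding m b(2)[symmetric] j_def by simp
    then have "(W (2 * of_nat m - 1 - 2 * (of_nat N - 1)) * E') $ m
        = (\<Sum>l=0..m. E' $ l * W (2 * of_nat e - j) $ (m - l))"
      by (simp only: mult.commute[of _ E'] fps_mult_nth)
    also have "\<dots> = (\<Sum>l=0+b..e+b. E' $ l * W (2 * of_nat e - j) $ (m - l))"
      unfolding m by (intro sum.mono_neutral_right) (auto simp: E'_def)
    also have "\<dots> = (\<Sum>r=0..e. E' $ (r + b) * W (2 * of_nat e - j) $ (e - r))"
      unfolding sum.shift_bounds_cl_nat_ivl m by simp
    also have "\<dots> = (\<Sum>r=0..e. (j - 2 * of_nat r) * W j $ r * W (2 * of_nat e - j) $ (e - r)) / j"
      by (simp add: E'_def sum_divide_distrib)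
    also have "\<dots> = (if e = 0 then 1 else 0)"
      unfolding orthogonality using nz[of \<beta>] by (simp add: j_def)
    finally show ?thesis by (simp add: m)
  qed
  have low: "(W (2 * of_nat m - 1 - 2 * (of_nat N - 1)) * E) $ m
      = (W (2 * of_nat m - 1 - 2 * (of_nat N - 1)) * E') $ m" if "m < N" for m
  proof (cases "m = 0")
    case True
    then show ?thesis using b E_0 by (simp add: E'_def)
  next
    case False
    then show ?thesis using that E[of m] E'[of m] by (simp add: b_def)
  qed
  have EE': "E $ m = E' $ m" if "m < N" for m
    by (rule fps_mult_cancel_low_order[where W = "\<lambda>m. W (2 * of_nat m - 1 - 2 * (of_nat N - 1))",
        OF low _ that]) simp_all
  \<comment> \<open>Lagrange inversion for (z/p)^n with n = 2k - 1 at m = \<beta> - k, where 2m + n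
    = j.\<close>
  have E_nth: "E $ (N - k) = (inverse f ^ (2 * k - 1)) $ (\<beta> - k)" if k: "k \<in> {1..\<beta>}" for k
  proof -
    have nat: "of_nat (2 * k - 1) = 2 * (of_nat k :: rat) - 1"
      using k by (simp add: of_nat_diff)
    have "2 * of_nat (\<beta> - k) + of_nat (2 * k - 1) = j"
      using k by (simp add: nat of_nat_diff j_def)
    then have *: "j * (inverse f ^ (2 * k - 1)) $ (\<beta> - k) = (2 * of_nat k - 1) * W j $ (\<beta> - k)"
      using fi[of "\<beta> - k" "2 * k - 1"] nat by simp
    have "N - k < N" "b \<le> N - k" "N - k - b = \<beta> - k" using k b by auto
    then have "E $ (N - k) = (j - 2 * of_nat (\<beta> - k)) / j * W j $ (\<beta> - k)"
      by (simp add: EE' E'_def)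
    also have "j - 2 * of_nat (\<beta> - k) = 2 * of_nat k - 1"
      using k by (simp add: of_nat_diff j_def)
    finally have "j * E $ (N - k) = (2 * of_nat k - 1) * W j $ (\<beta> - k)"
      using nz[of \<beta>] by (simp add: j_def)
    then show ?thesis
      using * nz[of \<beta>] by (metis j_def mult_left_cancel)
  qed

  let ?t = "\<lambda>k. 1 / of_nat (2 * k - 1) * (f ^ (2 * k - 1)) $ (\<alpha> + k - 1) * (inverse f ^ (2 * k - 1)) $ (\<beta> - k)"
  have "(W i * E) $ (N - 1 + \<alpha>) = (\<Sum>m=0..N-1+\<alpha>. E $ m * W i $ (N - 1 + \<alpha> - m))"
    by (subst mult.commute) (rule fps_mult_nth)
  also have "\<dots> = (\<Sum>m=b..N-1. E $ m * W i $ (N - 1 + \<alpha> - m))"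
  proof (intro sum.mono_neutral_right ballI)
    fix m assume "m \<in> {0..N-1+\<alpha>} - {b..N-1}"
    then have "m < b \<or> m \<ge> N" by auto
    then show "E $ m * W i $ (N - 1 + \<alpha> - m) = 0"
      using b by (auto simp: EE' E'_def E_high)
  qed auto
  also have "\<dots> = (\<Sum>k=1..\<beta>. E $ (N - k) * W i $ (\<alpha> + k - 1))"
  proof (rule sum.reindex_bij_witness[where i = "\<lambda>k. N - k" and j = "\<lambda>m. N - m"])
    fix m assume m: "m \<in> {b..N-1}"
    then have "m < N" using b \<beta> by auto
    then have "N - 1 + \<alpha> - m = \<alpha> + (N - m) - 1" by auto
    then show "E $ (N - (N - m)) * W i $ (\<alpha> + (N - m) - 1) = E $ m * W i $ (N - 1 + \<alpha> - m)"
      using \<open>m < N\<close> by simp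
  qed (use b \<beta> in auto)
  also have "\<dots> = (\<Sum>k=1..\<beta>. - (i * ?t k))"
  proof (intro sum.cong refl)
    fix k assume k: "k \<in> {1..\<beta>}"
    have nat: "of_nat (2 * k - 1) = 2 * (of_nat k :: rat) - 1"
      using k by (simp add: of_nat_diff)
    \<comment> \<open>Lagrange inversion for (p/z)^n with n = 2k - 1 at m = \<alpha> + k - 1, where
      2m - n = i.\<close>
    have "2 * of_nat (\<alpha> + k - 1) - of_nat (2 * k - 1) = i"
      using k \<alpha> by (simp add: nat of_nat_diff i_def)
    then have "i * (f ^ (2 * k - 1)) $ (\<alpha> + k - 1) = - (2 * of_nat k - 1) * W i $ (\<alpha> + k - 1)"
      using f[of "\<alpha> + k - 1" "2 * k - 1"] nat by simp
    then have "W i $ (\<alpha> + k - 1) = - (i * (1 / of_nat (2 * k - 1) * (f ^ (2 * k - 1)) $ (\<alpha> + k - 1)))"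
      unfolding nat using nz[of k] by (simp add: field_simps)
    then show "E $ (N - k) * W i $ (\<alpha> + k - 1) = - (i * ?t k)"
      unfolding E_nth[OF k] by (simp only: mult_ac minus_mult_right)
  qed
  also have "\<dots> = i * - (\<Sum>k=1..\<beta>. ?t k)"
    by (simp add: sum_negf sum_distrib_left)
  finally have lhs: "(W i * E) $ (N - 1 + \<alpha>) / i = - (\<Sum>k=1..\<beta>. ?t k)"
    using nz[of \<alpha>] by (simp add: i_def)

  \<comment> \<open>\<open>h\<close> agrees with \<open>f\<close> below order N. Only coefficients
    up to index \<alpha> + \<beta> - 1 enter, so \<alpha> + \<beta> \<le> N makes the truncation
    harmless.\<close>
  define h where "h = 1 - (\<Sum>g=1..N-1. fps_const (T g) * fps_X ^ g)"
  have h_nth: "h $ m = (if m = 0 then 1 else if m < N then - T m else 0)" for m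
  proof -
    have "(\<Sum>g=1..N-1. fps_const (T g) * fps_X ^ g) $ m = (\<Sum>g=1..N-1. if g = m then T g else 0)"
      unfolding fps_sum_nth by (intro sum.cong refl) (auto simp: fps_X_power_nth)
    then show ?thesis by (auto simp: h_def)
  qed
  have fh: "f $ m = h $ m" if "m < N" for m
  proof (cases "m = 0")
    case True
    then show ?thesis by (simp add: f0 h_nth)
  next
    case False
    then have "(2 * of_nat m - 1) * f $ m = (2 * of_nat m - 1) * - T m"
      using f[of m 1] T[of m] that by simp
    then have "f $ m = - T m" using nz[of m] by (simp only: mult_cancel_left) simp
    then show ?thesis using False that by (simp add: h_nth)
  qed
  have pow: "(h ^ n) $ m = (f ^ n) $ m" "(inverse h ^ n) $ m = (inverse f ^ n) $ m" if "m < N" for n m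
  proof -
    show "(h ^ n) $ m = (f ^ n) $ m"
      using fh that by (intro fps_power_nth_cong[of N]) auto
    show "(inverse h ^ n) $ m = (inverse f ^ n) $ m"
      using fh that f0 by (intro fps_power_nth_cong[of N] fps_inverse_nth_cong[of N]) (auto simp: h_nth)
  qed
  let ?s = "\<lambda>n. 1 / of_nat n * ((h ^ n oo fps_X ^ 2) $ (2 * \<alpha> - 1 + n))
          * (if n \<le> 2 * \<beta> - 1 then (inverse h ^ n oo fps_X ^ 2) $ (2 * \<beta> - 1 - n) else 0)"
  \<comment> \<open>Even n drop out: 2\<alpha> - 1 + n is then odd, while h(x^2)^n has only even
    powers of x.\<close>
  have "(\<Sum>n=1..K. ?s n) = (\<Sum>n\<in>(\<lambda>k. 2 * k - 1) ` {1..\<beta>}. ?s n)"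
  proof (intro sum.mono_neutral_right ballI)
    fix n assume n: "n \<in> {1..K} - (\<lambda>k. 2 * k - 1) ` {1..\<beta>}"
    have "even n \<or> n > 2 * \<beta> - 1"
    proof (rule ccontr)
      assume "\<not> ?thesis"
      then obtain k where "n = 2 * k + 1" "2 * k + 1 \<le> 2 * \<beta> - 1" by (auto elim: oddE)
      then have "n = 2 * (k + 1) - 1" "k + 1 \<in> {1..\<beta>}" by auto
      then show False using n by blast
    qed
    then show "?s n = 0" using \<alpha> by (auto simp: fps_compose_X2_nth)
  qed (use K in auto)
  also have "\<dots> = (\<Sum>k=1..\<beta>. ?s (2 * k - 1))"
  proof -
    have "inj_on (\<lambda>k. 2 * k - 1 :: nat) {1..\<beta>}" by (auto simp: inj_on_def)
    from sum.reindex[OF this, of ?s] show ?thesis by (simp only: o_def)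
  qed
  also have "\<dots> = (\<Sum>k=1..\<beta>. ?t k)"
  proof (intro sum.cong refl)
    fix k assume k: "k \<in> {1..\<beta>}"
    have *: "2 * \<alpha> - 1 + (2 * k - 1) = 2 * (\<alpha> + k - 1)" "2 * \<beta> - 1 - (2 * k - 1) = 2 * (\<beta> - k)"
      "2 * k - 1 \<le> 2 * \<beta> - 1" "\<alpha> + k - 1 < N" "\<beta> - k < N"
      using k \<alpha> \<alpha>\<beta> by auto
    then show "?s (2 * k - 1) = ?t k"
      unfolding * by (simp add: fps_compose_X2_nth pow)
  qed
  finally have "(\<Sum>n=1..K. ?s n) = (\<Sum>k=1..\<beta>. ?t k)" .
  moreover have "1 \<le> 2 * \<alpha> - 1" using \<alpha> by simp
  ultimately show ?thesis
    using log_kernel_coeff[where i = "2 * \<alpha> - 1" and j = "2 * \<beta> - 1" and K = K and M = "N - 1" and T = T] lhs K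
    unfolding h_def[symmetric] i_def by simp
qed

text \<open>With \<open>\<lambda> = p\<^bsup>2(N-1)\<^esup> + 2 (N - 1) (\<Sum>\<^sub>k v\<^sub>k p\<^bsup>2(k-1)\<^esup>)\<close> and \<open>u = p\<^sup>-\<^sup>2\<close>, this is
  \<open>p\<^sup>-\<^sup>j \<lambda>\<^bsup>j/(2(N-1))\<^esup>\<close>.\<close>

definition flat_series :: "nat \<Rightarrow> (nat \<Rightarrow> rat) \<Rightarrow> rat \<Rightarrow> rat fps" where
  "flat_series N v j = fps_binomial (j / (2 * (of_nat N - 1)))
     oo (fps_const (2 * (of_nat N - 1)) * coord_series N v)"

section \<open>Coordinates and potential as coefficients of powers of lambda\<close>

lemma coord_series_nth_0 [simp]: "coord_series N v $ 0 = 0"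
  by (simp add: coord_series_nth)

lemma series_powers_flat_series:
  assumes "N \<ge> 2"
  shows "\<exists>ell. series_powers (flat_series N v) ell"
proof -
  have "2 * (of_nat N - 1) \<noteq> (0::rat)"
    using assms of_nat_eq_iff[of N 1, where 'a = rat] by auto
  from series_powers_binomial[OF this coord_series_nth_0, of N v]
  show ?thesis unfolding flat_series_def[abs_def] by blast
qed

lemma flat_series_mult_nth:
  "(flat_series N v j * D) $ m = (\<Sum>n=0..m. (j / (2 * (of_nat N - 1)) gchoose n) *
     ((2 * (of_nat N - 1)) ^ n * (coord_series N v ^ n * D) $ m))"
  unfolding flat_series_def
  by (subst fps_compose_mult_nth)
    (simp_all add: power_mult_distrib fps_const_power mult.assoc)

lemma power_mult_nth_eq_0:
  fixes V D :: "'a::comm_ring_1 fps"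
  assumes "V $ 0 = 0" "D $ 0 = 0"
  shows "(V ^ n * D) $ n = 0"
  unfolding fps_mult_nth
proof (rule sum.neutral, rule ballI)
  fix l assume "l \<in> {0..n}"
  then show "(V ^ n) $ l * D $ (n - l) = 0"
    using assms startsby_zero_power_prefix[OF assms(1), of n] by (cases "l = n") auto
qed

context
  fixes N :: nat and v :: "nat \<Rightarrow> rat mpoly" and x :: "nat \<Rightarrow> rat" and c :: rat
  assumes N: "N \<ge> 2"
  defines "c \<equiv> 2 * (of_nat N - 1)"
begin

private abbreviation (input) "V \<equiv> coord_series N (\<lambda>k. eval x (v k))"
private abbreviation (input) "D i \<equiv> coord_series N (\<lambda>k. eval x (pderiv i (v k)))"
private abbreviation (input) "W \<equiv> flat_series N (\<lambda>k. eval x (v k))"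

lemma c_nonzero: "c \<noteq> 0"
  using N of_nat_eq_iff[of N 1, where 'a = rat] by (auto simp: c_def)

text \<open>The exponent 2m - 1 - c arises because differentiating z^(2m-1) = lambda^((2m-1)/c)
  lowers the power of z by c.\<close>

lemma t_of_v_coeff:
  assumes "m \<in> {1..N-1}"
  shows "(- 1) ^ n * (\<Prod>k<n. 2 * of_nat (N - m) - 1 + 2 * of_nat k * (of_nat N - 1))
    = c ^ n * fact n * ((2 * of_nat m - 1 - c) / c gchoose n)"
proof -
  have "2 * of_nat (N - m) - 1 + 2 * of_nat k * (of_nat N - 1)
      = of_nat k * c - c * ((2 * of_nat m - 1 - c) / c)" for k
  proof -
    have "c * ((2 * of_nat m - 1 - c) / c) = 2 * of_nat m - 1 - c"
      using c_nonzero by simp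
    moreover have "of_nat (N - m) = of_nat N - (of_nat m :: rat)"
      using assms by (intro of_nat_diff) auto
    ultimately show ?thesis by (simp only:) (simp add: c_def algebra_simps)
  qed
  then show ?thesis by (simp only: prod_arith_progression)
qed

lemma t_of_v_eq_weighted_poly:
  "t_of_v N v \<gamma> = weighted_poly N v (N - \<gamma>) (\<lambda>n. (- 1) ^ (n - 1) *
     (\<Prod>k<n-1. 2 * of_nat \<gamma> - 1 + 2 * of_nat k * (of_nat N - 1)))"
  by (simp add: t_of_v_def weighted_poly_def)

lemma dF_of_v_eq_weighted_poly:
  "dF_of_v N v \<alpha> = weighted_poly N v (N - 1 + \<alpha>) (\<lambda>n. (- 1) ^ n *
     (\<Prod>k<n-2. 2 * (of_nat N - of_nat \<alpha>) - 1 + 2 * of_nat k * (of_nat N - 1)))"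
  by (simp add: dF_of_v_def weighted_poly_def)

text \<open>The right side is the residue of z^(2m-1) dp. The product in t has one factor fewer than
  the binomial coefficient; absorption supplies it and produces 2m - 1.\<close>

lemma eval_t_of_v:
  assumes m: "m \<in> {1..N-1}"
  shows "(2 * of_nat m - 1) * eval x (t_of_v N v (N - m)) = W (2 * of_nat m - 1) $ m"
proof -
  define s where "s = (2 * of_nat m - 1) / c"
  have r: "(2 * of_nat m - 1 - c) / c = s - 1" using c_nonzero by (simp add: s_def diff_divide_distrib)
  have cs: "2 * of_nat m - 1 = c * s" using c_nonzero by (simp add: s_def)
  let ?C = "\<lambda>n. (- 1) ^ (n - 1) *
     (\<Prod>k<n-1. 2 * of_nat (N - m) - 1 + 2 * of_nat k * (of_nat N - 1)) :: rat"
  have "(2 * of_nat m - 1) * (?C n / fact n * (V ^ n) $ m) = (s gchoose n) * (c ^ n * (V ^ n) $ m)" for n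
  proof (cases n)
    case 0
    then show ?thesis using m by simp
  next
    case (Suc l)
    have "(2 * of_nat m - 1) * (?C n / fact n) = c ^ n * (s * ((s - 1) gchoose l)) / of_nat (Suc l)"
      unfolding Suc diff_Suc_1 t_of_v_coeff[OF m] r unfolding cs by (simp add: fact_Suc del: of_nat_Suc)
    also have "s * ((s - 1) gchoose l) = of_nat (Suc l) * (s gchoose Suc l)"
      by (rule gbinomial_absorption[symmetric])
    finally have "(2 * of_nat m - 1) * (?C n / fact n) = c ^ n * (s gchoose n)"
      by (simp add: Suc del: of_nat_Suc)
    then show ?thesis by (simp only: mult.assoc[symmetric]) (simp add: mult_ac)
  qed
  moreover have "N - (N - m) = m" using m by auto
  ultimately show ?thesis
    using flat_series_mult_nth[of N "\<lambda>k. eval x (v k)" "2 * of_nat m - 1" 1 m]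
    by (simp add: t_of_v_eq_weighted_poly eval_weighted_poly sum_distrib_left s_def c_def)
qed

lemma eval_pderiv_t_of_v:
  assumes m: "m \<in> {1..N-1}"
  shows "eval x (pderiv i (t_of_v N v (N - m))) = (W (2 * of_nat m - 1 - c) * D i) $ m"
proof -
  have "N - (N - m) = m" using m by auto
  then have "eval x (pderiv i (t_of_v N v (N - m)))
      = (\<Sum>n<m. ((2 * of_nat m - 1 - c) / c gchoose n) * (c ^ n * (V ^ n * D i) $ m))"
    unfolding t_of_v_eq_weighted_poly eval_pderiv_weighted_poly diff_Suc_1 t_of_v_coeff[OF m]
    by (simp add: mult_ac)
  \<comment> \<open>The extra term n = m on the right vanishes because both series lack a constant
    term.\<close>
  also have "\<dots> = (W (2 * of_nat m - 1 - c) * D i) $ m"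
    unfolding flat_series_mult_nth c_def[symmetric]
    by (intro sum.mono_neutral_left) (auto simp: not_less intro!: power_mult_nth_eq_0)
  finally show ?thesis .
qed

text \<open>The product is two factors short of the binomial coefficient for z^(2N-2+2\<alpha>-1).
  Differentiation accounts for one, absorption for the other, leaving the denominator 2\<alpha> -
  1.\<close>

lemma eval_pderiv_dF_of_v:
  assumes \<alpha>: "\<alpha> \<ge> 1"
  shows "eval x (pderiv i (dF_of_v N v \<alpha>)) = (W (2 * of_nat \<alpha> - 1) * D i) $ (N - 1 + \<alpha>) / (2 * of_nat \<alpha> - 1)"
proof -
  let ?w = "N - 1 + \<alpha>"
  let ?C = "\<lambda>n. (- 1) ^ n *
     (\<Prod>k<n-2. 2 * (of_nat N - of_nat \<alpha>) - 1 + 2 * of_nat k * (of_nat N - 1)) :: rat"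
  define s where "s = (2 * of_nat \<alpha> - 1) / c"
  have cs: "2 * of_nat \<alpha> - 1 = c * s" using c_nonzero by (simp add: s_def)
  have "of_nat 1 \<le> (of_nat \<alpha> :: rat)" using \<alpha> by (simp only: of_nat_le_iff)
  then have \<alpha>0: "2 * of_nat \<alpha> - 1 \<noteq> (0::rat)" by simp
  have "?C (Suc n) / fact n * (V ^ n * D i) $ ?w
      = (s gchoose n) * (c ^ n * (V ^ n * D i) $ ?w) / (2 * of_nat \<alpha> - 1)" for n
  proof (cases n)
    case 0
    \<comment> \<open>For size 1 the bound \<open>n - 2\<close> truncates and the general formula
      fails; the term vanishes since \<open>D i\<close> has degree at most N - 1.\<close>
    have "D i $ ?w = 0" using \<alpha> N by (auto simp: coord_series_nth)
    then show ?thesis by (simp add: 0)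
  next
    case (Suc l)
    have "2 * (of_nat N - of_nat \<alpha>) - 1 + 2 * of_nat k * (of_nat N - 1)
        = of_nat k * c - c * (s - 1)" for k
      unfolding right_diff_distrib cs[symmetric] by (simp add: c_def algebra_simps)
    then have "?C (Suc n) = c ^ l * fact l * ((s - 1) gchoose l)"
      by (simp only: Suc prod_arith_progression[symmetric]) simp
    then have "(2 * of_nat \<alpha> - 1) * (?C (Suc n) / fact n)
        = c ^ n * (s * ((s - 1) gchoose l)) / of_nat (Suc l)"
      unfolding cs by (simp add: Suc fact_Suc del: of_nat_Suc)
    also have "s * ((s - 1) gchoose l) = of_nat (Suc l) * (s gchoose Suc l)"
      by (rule gbinomial_absorption[symmetric])
    finally have "(2 * of_nat \<alpha> - 1) * (?C (Suc n) / fact n) = c ^ n * (s gchoose n)"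
      by (simp add: Suc del: of_nat_Suc)
    then have "?C (Suc n) / fact n = c ^ n * (s gchoose n) / (2 * of_nat \<alpha> - 1)"
      using \<alpha>0 by (metis nonzero_mult_div_cancel_left)
    then show ?thesis by (simp only: mult_ac times_divide_eq_right times_divide_eq_left)
  qed
  then have "eval x (pderiv i (dF_of_v N v \<alpha>))
      = (\<Sum>n<?w. (s gchoose n) * (c ^ n * (V ^ n * D i) $ ?w)) / (2 * of_nat \<alpha> - 1)"
    unfolding dF_of_v_eq_weighted_poly eval_pderiv_weighted_poly by (simp only: sum_divide_distrib)
  also have "(\<Sum>n<?w. (s gchoose n) * (c ^ n * (V ^ n * D i) $ ?w)) = (W (2 * of_nat \<alpha> - 1) * D i) $ ?w"
    unfolding flat_series_mult_nth c_def[symmetric] s_def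
    by (intro sum.mono_neutral_left) (auto simp: not_less intro!: power_mult_nth_eq_0)
  finally show ?thesis .
qed

end

section \<open>Taylor coefficients of the second derivative at the origin\<close>

theorem corollary5p3:
  fixes N \<alpha> \<beta> :: nat and F :: "rat mpoly" and \<gamma>s :: "nat list"
  assumes "N \<ge> 4"
    and "is_D_potential N F"
    and "\<alpha> \<ge> 1" and "\<beta> \<ge> 1" and "\<alpha> + \<beta> \<le> N"
    and "length \<gamma>s \<ge> 1" and "set \<gamma>s \<subseteq> {1..N-1}"
  shows "eval (\<lambda>_. 0) (pderivs (\<alpha> # \<beta> # map (\<lambda>\<gamma>. N - \<gamma>) \<gamma>s) F)
    = (-1) ^ (length \<gamma>s - 1) * fact (length \<gamma>s - 1) *
      of_nat (P_hat (2 * \<alpha> - 1) (2 * \<beta> - 1) (map (\<lambda>\<gamma>. 2 * \<gamma> - 1) \<gamma>s))"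
proof -
  have N: "N \<ge> 2" and \<alpha>: "\<alpha> \<in> {1..N-1}" and \<beta>: "\<beta> \<in> {1..N-1}"
    using assms by auto
  from assms(2) obtain v where
    coords: "\<And>\<gamma>. \<gamma> \<in> {1..N-1} \<Longrightarrow> t_of_v N v \<gamma> = Var \<gamma>" and
    dF: "set_var_zero N (pderiv \<alpha> F) = dF_of_v N v \<alpha>"
    unfolding is_D_potential_def is_D_coords_def using \<alpha> by blast
  define L where "L = length \<gamma>s"
  \<comment> \<open>At least 2\<beta> - 1, so the logarithm is complete, and at least
    \<open>L\<close>, so the summand of degree \<open>L\<close> is present even where its
    coefficient is zero.\<close>
  define K where "K = 2 * \<beta> - 1 + L"
  define f where "f l = ((prod_list (map pair_kernel l) * 1) $ (2 * \<beta> - 1)) $$ int (2 * \<alpha> - 1)" for l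
  define a where "a n = (- 1) ^ (n - 1) / (of_nat n :: rat)" for n
  define P where "P = (\<Sum>n\<in>{1..K}. Const (a n) * form_poly {1..N-1} (\<lambda>g. N - g) f n)"

  \<comment> \<open>Only values on the hyperplane t_N = 0 are compared; this suffices because no
    remaining derivative is taken along t_N.\<close>
  have dd: "eval x (pderiv \<beta> (pderiv \<alpha> F)) = eval x P" if x: "x N = 0" for x
  proof -
    obtain ell where W: "series_powers (flat_series N (\<lambda>k. eval x (v k))) ell"
      using series_powers_flat_series[OF N] by blast
    have "eval (x(\<beta> := t)) (pderiv \<alpha> F) = eval (x(\<beta> := t)) (dF_of_v N v \<alpha>)" for t
    proof -
      have "(x(\<beta> := t))(N := 0) = x(\<beta> := t)" using x \<beta> N by (intro fun_upd_idem) auto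
      then show ?thesis unfolding dF[symmetric] eval_set_var_zero by simp
    qed
    then have "eval x (pderiv \<beta> (pderiv \<alpha> F)) = eval x (pderiv \<beta> (dF_of_v N v \<alpha>))"
      by (rule eval_pderiv_cong)
    also have "\<dots> = (\<Sum>n=1..K. a n *
        (((\<Sum>g=1..N-1. fps_const (fls_const (x (N - g))) * pair_kernel g) ^ n) $ (2 * \<beta> - 1)) $$ int (2 * \<alpha> - 1))"
      unfolding eval_pderiv_dF_of_v[OF N assms(3)] a_def
    proof (rule second_derivative_coeff[OF W assms(3-5)])
      show "2 * \<beta> - 1 \<le> K" by (simp add: K_def)
      fix m assume m: "m \<in> {1..N-1}"
      then have t: "t_of_v N v (N - m) = Var (N - m)" by (intro coords) auto
      show "flat_series N (\<lambda>k. eval x (v k)) (2 * of_nat m - 1) $ m = (2 * of_nat m - 1) * x (N - m)"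
        using eval_t_of_v[OF N m, of x v] unfolding t by simp
      have "N - m = \<beta> \<longleftrightarrow> m = N - \<beta>" using m \<beta> by auto
      then show "(flat_series N (\<lambda>k. eval x (v k)) (2 * of_nat m - 1 - 2 * (of_nat N - 1))
          * coord_series N (\<lambda>k. eval x (pderiv \<beta> (v k)))) $ m = (if m = N - \<beta> then 1 else 0)"
        using eval_pderiv_t_of_v[OF N m, of x \<beta> v] unfolding t by simp
    qed (use N in \<open>auto simp: coord_series_nth\<close>)
    also have "\<dots> = eval x P"
      unfolding P_def f_def by (simp add: eval_form_poly_kernel del: mult_1_right) simp
    finally show ?thesis .
  qed

  have f: "f \<gamma>s = of_nat (P_hat (2 * \<alpha> - 1) (2 * \<beta> - 1) (map (\<lambda>\<gamma>. 2 * \<gamma> - 1) \<gamma>s))"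
  proof -
    have "\<forall>g\<in>set \<gamma>s. g \<ge> 1" using assms(7) by auto
    then show ?thesis by (simp add: f_def prod_pair_kernel_nth nat_diff_distrib' flip: of_nat_diff)
  qed
  have "pderivs (\<alpha> # \<beta> # map (\<lambda>\<gamma>. N - \<gamma>) \<gamma>s) F
      = pderivs (map (\<lambda>\<gamma>. N - \<gamma>) \<gamma>s) (pderiv \<beta> (pderiv \<alpha> F))"
    unfolding pderivs_pderiv by (simp add: pderivs_def pderiv_commute[of \<alpha> \<beta>])
  then have "eval (\<lambda>_. 0) (pderivs (\<alpha> # \<beta> # map (\<lambda>\<gamma>. N - \<gamma>) \<gamma>s) F)
      = eval (\<lambda>_. 0) (pderivs (map (\<lambda>\<gamma>. N - \<gamma>) \<gamma>s) (pderiv \<beta> (pderiv \<alpha> F)))"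
    by (rule arg_cong)
  also have "\<dots> = eval (\<lambda>_. 0) (pderivs (map (\<lambda>\<gamma>. N - \<gamma>) \<gamma>s) P)"
  proof (rule eval_pderivs_cong[of N])
    have "N - \<gamma> \<noteq> N" if "\<gamma> \<in> set \<gamma>s" for \<gamma>
      using subsetD[OF assms(7) that] N by auto
    then show "N \<notin> set (map (\<lambda>\<gamma>. N - \<gamma>) \<gamma>s)"
      unfolding set_map by (metis imageE)
  qed (simp_all add: dd)
  also have "\<dots> = a L * fact L * f \<gamma>s"
    unfolding P_def L_def
  proof (rule eval_0_pderivs_form_series)
    show "inj_on (\<lambda>g. N - g) {1..N-1}" by (auto simp: inj_on_def)
    show "symmetric_form f" unfolding f_def by (rule symmetric_form_prod_kernel)
    show "length \<gamma>s \<in> {1..K}" using assms(6) by (simp add: K_def L_def)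
  qed (use assms(7) in auto)
  also have "a L * fact L = (- 1) ^ (L - 1) * fact (L - 1)"
    using assms(6) by (cases L) (simp_all add: a_def L_def fact_Suc del: of_nat_Suc)
  finally show ?thesis by (simp only: f L_def)
qed

end
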